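(* Let $R$ and $S$ be the rings of algebraic integers in the number fields $K$ and $L$, respectively. Then any injective homomorphism $\alpha:R\to S$ of rings induces naturally a *-homomorphism $\mathfrak T[R]\to\mathfrak T[S]$.
   Context: For a ring $R$ of algebraic integers, $R^\times=R\setminus\{0\}$ and ideals are always non-zero. $\mathfrak T[R]$ is the universal C*-algebra generated by $u^x$ ($x\in R$), $s_a$ ($a\in R^\times$), $e_I$ ($I$ a non-zero ideal) with relations: (Ta) the $u^x$ are unitary with $u^xu^y=u^{x+y}$, the $s_a$ are isometries with $s_as_b=s_{ab}$, and $s_au^x=u^{ax}s_a$; (Tb) the $e_I$ are projections, $e_{I\cap J}=e_Ie_J$, $e_R=1$; (Tc) $s_ae_Is_a^*=e_{aI}$; (Td) $u^xe_I=e_Iu^x$ if $x\in I$, $e_Iu^xe_I=0$ if $x\notin I$. "Induces naturally" means: denoting by $\bar u^x,\bar s_a,\bar e_I$ the generators of $\mathfrak T[S]$, there is a *-homomorphism with $u^x\mapsto\bar u^{\alpha(x)}$, $s_a\mapsto\bar s_{\alpha(a)}$ and $e_I\mapsto\bar e_{\alpha(I)S}$, where $\alpha(I)S$ is the ideal of $S$ generated by $\alpha(I)$. *)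

theory Defs
  imports
    Complex_Main
    "HOL-Library.Poly_Mapping"
    "HOL-Computational_Algebra.Polynomial"
    "HOL-Algebra.RingHom"
    "HOL-Algebra.Module"
begin

section \<open>Unital C*-algebras\<close>

definition complex_ring :: "complex ring"
  where "complex_ring = \<lparr>carrier = UNIV, mult = (*), one = 1, zero = 0, add = (+)\<rparr>"

record 'a star_alg = "(complex, 'a) module" +
  adj :: "'a \<Rightarrow> 'a"
  nrm :: "'a \<Rightarrow> real"

locale cstar_algebra = ring A for A (structure) +
  assumes complex_module: "module complex_ring A"
    and smult_mult_left: "\<lbrakk>x \<in> carrier A; y \<in> carrier A\<rbrakk> \<Longrightarrow> (c \<odot> x) \<otimes> y = c \<odot> (x \<otimes> y)"
    and smult_mult_right: "\<lbrakk>x \<in> carrier A; y \<in> carrier A\<rbrakk> \<Longrightarrow> x \<otimes> (c \<odot> y) = c \<odot> (x \<otimes> y)"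
    and adj_closed: "x \<in> carrier A \<Longrightarrow> adj A x \<in> carrier A"
    and adj_adj: "x \<in> carrier A \<Longrightarrow> adj A (adj A x) = x"
    and adj_add: "\<lbrakk>x \<in> carrier A; y \<in> carrier A\<rbrakk> \<Longrightarrow> adj A (x \<oplus> y) = adj A x \<oplus> adj A y"
    and adj_smult: "x \<in> carrier A \<Longrightarrow> adj A (c \<odot> x) = cnj c \<odot> adj A x"
    and adj_mult: "\<lbrakk>x \<in> carrier A; y \<in> carrier A\<rbrakk> \<Longrightarrow> adj A (x \<otimes> y) = adj A y \<otimes> adj A x"
    and nrm_eq_0: "x \<in> carrier A \<Longrightarrow> nrm A x = 0 \<longleftrightarrow> x = \<zero>"
    and nrm_add: "\<lbrakk>x \<in> carrier A; y \<in> carrier A\<rbrakk> \<Longrightarrow> nrm A (x \<oplus> y) \<le> nrm A x + nrm A y"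
    and nrm_smult: "x \<in> carrier A \<Longrightarrow> nrm A (c \<odot> x) = cmod c * nrm A x"
    and nrm_mult: "\<lbrakk>x \<in> carrier A; y \<in> carrier A\<rbrakk> \<Longrightarrow> nrm A (x \<otimes> y) \<le> nrm A x * nrm A y"
    and nrm_cstar: "x \<in> carrier A \<Longrightarrow> nrm A (adj A x \<otimes> x) = (nrm A x)\<^sup>2"
    and nrm_complete:
      "\<lbrakk>\<And>n. X n \<in> carrier A;
        \<And>e. e > 0 \<Longrightarrow> \<exists>k. \<forall>m\<ge>k. \<forall>n\<ge>k. nrm A (X m \<ominus> X n) < e\<rbrakk>
       \<Longrightarrow> \<exists>l\<in>carrier A. (\<lambda>n. nrm A (X n \<ominus> l)) \<longlonglongrightarrow> 0"

definition star_hom :: "('a, 'm) star_alg_scheme \<Rightarrow> ('b, 'n) star_alg_scheme \<Rightarrow> ('a \<Rightarrow> 'b) \<Rightarrow> bool"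
  where "star_hom A B f \<longleftrightarrow>
    f \<in> carrier A \<rightarrow> carrier B \<and>
    (\<forall>x\<in>carrier A. \<forall>y\<in>carrier A. f (x \<oplus>\<^bsub>A\<^esub> y) = f x \<oplus>\<^bsub>B\<^esub> f y) \<and>
    (\<forall>x\<in>carrier A. \<forall>y\<in>carrier A. f (x \<otimes>\<^bsub>A\<^esub> y) = f x \<otimes>\<^bsub>B\<^esub> f y) \<and>
    (\<forall>c. \<forall>x\<in>carrier A. f (c \<odot>\<^bsub>A\<^esub> x) = c \<odot>\<^bsub>B\<^esub> f x) \<and>
    (\<forall>x\<in>carrier A. f (adj A x) = adj B (f x))"


section \<open>Noncommutative *-polynomials\<close>

text \<open>
  The free unital *-algebra on a type of generators is the monoid algebra over the complex numbers
  of the free monoid on the letters \<open>(g, False)\<close>, standing for \<open>g\<close>, and \<open>(g, True)\<close>, standing for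
  the adjoint of \<open>g\<close>. The convolution product of \<^theory>\<open>HOL-Library.Poly_Mapping\<close> expects the
  monoid operation to be written additively, whence concatenation is \<open>+\<close> on words.
\<close>

datatype 'g word = Word (letters: "('g \<times> bool) list")

instantiation word :: (type) monoid_add
begin
definition "0 = Word []"
definition "v + w = Word (letters v @ letters w)"
instance by standard (auto simp: zero_word_def plus_word_def)
end

type_synonym 'g star_poly = "'g word \<Rightarrow>\<^sub>0 complex"

definition word_adj :: "'g word \<Rightarrow> 'g word"
  where "word_adj w = Word (rev (map (apsnd Not) (letters w)))"

definition poly_adj :: "'g star_poly \<Rightarrow> 'g star_poly"
  where "poly_adj p =
    (\<Sum>w\<in>Poly_Mapping.keys p. Poly_Mapping.single (word_adj w) (cnj (Poly_Mapping.lookup p w)))"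

definition poly_scale :: "complex \<Rightarrow> 'g star_poly \<Rightarrow> 'g star_poly"
  where "poly_scale c p = Poly_Mapping.single 0 c * p"

definition poly_gen :: "'g \<Rightarrow> 'g star_poly"
  where "poly_gen g = Poly_Mapping.single (Word [(g, False)]) 1"

definition star_polys :: "'g set \<Rightarrow> 'g star_poly set"
  where "star_polys G = {p. \<forall>w\<in>Poly_Mapping.keys p. fst ` set (letters w) \<subseteq> G}"


lemma word_adj_adj [simp]: "word_adj (word_adj w) = w"
  by (cases w) (auto simp: word_adj_def rev_map o_def apsnd_def map_prod_def split_def)

lemma word_adj_inj: "inj_on word_adj A"
  by (metis inj_onI word_adj_adj)

lemma word_adj_zero [simp]: "word_adj 0 = 0"
  by (simp add: word_adj_def zero_word_def)

lemma word_adj_plus [simp]: "word_adj (v + w) = word_adj w + word_adj v"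
  by (simp add: word_adj_def plus_word_def)

lemma lookup_poly_adj: "Poly_Mapping.lookup (poly_adj p) w = cnj (Poly_Mapping.lookup p (word_adj w))"
proof -
  have "Poly_Mapping.lookup (poly_adj p) w =
      (\<Sum>v\<in>Poly_Mapping.keys p. if v = word_adj w then cnj (Poly_Mapping.lookup p v) else 0)"
    unfolding poly_adj_def lookup_sum
    by (rule sum.cong) (auto simp: lookup_single when_def)
  also have "\<dots> = cnj (Poly_Mapping.lookup p (word_adj w))"
    by (auto simp: not_in_keys_iff_lookup_eq_zero)
  finally show ?thesis .
qed

lemma poly_adj_adj [simp]: "poly_adj (poly_adj p) = p"
  by (rule poly_mapping_eqI) (simp add: lookup_poly_adj)

lemma poly_adj_zero [simp]: "poly_adj 0 = 0"
  by (rule poly_mapping_eqI) (simp add: lookup_poly_adj)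

lemma poly_adj_add: "poly_adj (p + q) = poly_adj p + poly_adj q"
  by (rule poly_mapping_eqI) (simp add: lookup_poly_adj lookup_add)

lemma poly_adj_diff: "poly_adj (p - q) = poly_adj p - poly_adj q"
  by (rule poly_mapping_eqI) (simp add: lookup_poly_adj lookup_minus)

lemma poly_adj_single: "poly_adj (Poly_Mapping.single w c) = Poly_Mapping.single (word_adj w) (cnj c)"
  by (rule poly_mapping_eqI) (auto simp: lookup_poly_adj lookup_single when_def)

lemma poly_adj_one [simp]: "poly_adj 1 = 1"
  by (metis poly_adj_single single_one complex_cnj_one word_adj_zero)

lemma keys_poly_adj: "Poly_Mapping.keys (poly_adj p) = word_adj ` Poly_Mapping.keys p"
  by (force simp: in_keys_iff lookup_poly_adj image_iff)

lemma poly_expand: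
  "p = (\<Sum>w\<in>Poly_Mapping.keys p. Poly_Mapping.single w (Poly_Mapping.lookup p w))"
proof (rule poly_mapping_eqI)
  fix w
  show "Poly_Mapping.lookup p w = Poly_Mapping.lookup
     (\<Sum>w\<in>Poly_Mapping.keys p. Poly_Mapping.single w (Poly_Mapping.lookup p w)) w"
    by (simp add: lookup_sum lookup_single when_def not_in_keys_iff_lookup_eq_zero)
qed

lemma star_polys_zero: "0 \<in> star_polys G"
  by (simp add: star_polys_def)

lemma star_polys_single: "fst ` set (letters w) \<subseteq> G \<Longrightarrow> Poly_Mapping.single w c \<in> star_polys G"
  by (simp add: star_polys_def)

lemma star_polys_one: "1 \<in> star_polys G"
  by (simp add: star_polys_def zero_word_def)

lemma star_polys_add: "p \<in> star_polys G \<Longrightarrow> q \<in> star_polys G \<Longrightarrow> p + q \<in> star_polys G"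
  using keys_add[of p q] by (auto simp: star_polys_def)

lemma star_polys_mult: "p \<in> star_polys G \<Longrightarrow> q \<in> star_polys G \<Longrightarrow> p * q \<in> star_polys G"
  using keys_mult[of p q] by (fastforce simp: star_polys_def plus_word_def)

lemma star_polys_scale: "p \<in> star_polys G \<Longrightarrow> poly_scale c p \<in> star_polys G"
  unfolding poly_scale_def by (intro star_polys_mult star_polys_single) (auto simp: zero_word_def)

lemma star_polys_adj: "p \<in> star_polys G \<Longrightarrow> poly_adj p \<in> star_polys G"
  by (fastforce simp: star_polys_def keys_poly_adj word_adj_def)

lemma star_polys_gen: "g \<in> G \<Longrightarrow> poly_gen g \<in> star_polys G"
  by (simp add: poly_gen_def star_polys_single)

lemma poly_scale_minus_one: "poly_scale (- 1) p = - p"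
  by (simp add: poly_scale_def single_uminus)

lemma star_polys_uminus: "p \<in> star_polys G \<Longrightarrow> - p \<in> star_polys G"
  using star_polys_scale[of p G "-1"] by (simp add: poly_scale_minus_one)

lemma star_polys_diff: "p \<in> star_polys G \<Longrightarrow> q \<in> star_polys G \<Longrightarrow> p - q \<in> star_polys G"
  using star_polys_add[OF _ star_polys_uminus, of p G q] by simp

lemmas star_polys_intros = star_polys_zero star_polys_one star_polys_add star_polys_mult
  star_polys_scale star_polys_adj star_polys_gen star_polys_uminus star_polys_diff

lemma star_polys_induct [consumes 1, case_names zero single_add]:
  assumes p: "p \<in> star_polys G"
    and 0: "P 0"
    and step: "\<And>w c q. fst ` set (letters w) \<subseteq> G \<Longrightarrow> q \<in> star_polys G \<Longrightarrow> P q
      \<Longrightarrow> P (Poly_Mapping.single w c + q)"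
  shows "P p"
proof -
  have "W \<subseteq> Poly_Mapping.keys p \<Longrightarrow>
    (\<Sum>w\<in>W. Poly_Mapping.single w (Poly_Mapping.lookup p w)) \<in> star_polys G \<and>
    P (\<Sum>w\<in>W. Poly_Mapping.single w (Poly_Mapping.lookup p w))" if "finite W" for W
    using that
  proof (induction W)
    case empty
    then show ?case by (simp add: 0 star_polys_zero)
  next
    case (insert w W)
    have "fst ` set (letters w) \<subseteq> G" using insert p by (auto simp: star_polys_def)
    with insert show ?case by (simp add: step star_polys_add star_polys_single)
  qed
  from this[of "Poly_Mapping.keys p"] show ?thesis
    using poly_expand[of p] by simp
qed

lemma star_polys_UNIV: "p \<in> star_polys UNIV"
  by (simp add: star_polys_def)

lemma poly_scale_single: "poly_scale c (Poly_Mapping.single w d) = Poly_Mapping.single w (c * d)"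
  by (simp add: poly_scale_def mult_single)

lemma poly_scale_add_right: "poly_scale c (p + q) = poly_scale c p + poly_scale c q"
  by (simp add: poly_scale_def distrib_left)

lemma poly_scale_add_left: "poly_scale (c + d) p = poly_scale c p + poly_scale d p"
  by (simp add: poly_scale_def distrib_right single_add)

lemma poly_scale_diff: "poly_scale c (p - q) = poly_scale c p - poly_scale c q"
  by (simp add: poly_scale_def right_diff_distrib)

lemma poly_scale_scale: "poly_scale c (poly_scale d p) = poly_scale (c * d) p"
  by (simp add: poly_scale_def mult.assoc[symmetric] mult_single)

lemma poly_scale_one: "poly_scale 1 p = p"
  by (simp add: poly_scale_def)

lemma poly_scale_zero: "poly_scale c 0 = 0"
  by (simp add: poly_scale_def)

lemma poly_scale_mult_left: "poly_scale c p * q = poly_scale c (p * q)"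
  by (simp add: poly_scale_def mult.assoc)

lemma poly_scale_mult_right: "p * poly_scale c q = poly_scale c (p * q)"
proof -
  have "p * Poly_Mapping.single 0 c = Poly_Mapping.single 0 c * p"
    using star_polys_UNIV[of p]
    by (induction rule: star_polys_induct) (simp_all add: algebra_simps mult_single)
  then show ?thesis by (simp add: poly_scale_def mult.assoc[symmetric])
qed

lemma poly_adj_scale: "poly_adj (poly_scale c p) = poly_scale (cnj c) (poly_adj p)"
  using star_polys_UNIV[of p]
  by (induction rule: star_polys_induct)
    (simp_all add: poly_scale_zero poly_scale_add_right poly_adj_add poly_adj_single poly_scale_single)

lemma poly_adj_single_mult:
  "poly_adj (Poly_Mapping.single w c * q) = poly_adj q * poly_adj (Poly_Mapping.single w c)"
  using star_polys_UNIV[of q]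
  by (induction rule: star_polys_induct)
    (simp_all add: algebra_simps mult_single poly_adj_add poly_adj_single)

lemma poly_adj_mult: "poly_adj (p * q) = poly_adj q * poly_adj p"
  using star_polys_UNIV[of p]
  by (induction rule: star_polys_induct)
    (simp_all add: distrib_left distrib_right poly_adj_add poly_adj_single_mult)


section \<open>The universal C*-algebra of a presentation\<close>

definition cstar_seminorm :: "'g set \<Rightarrow> ('g star_poly \<Rightarrow> real) \<Rightarrow> bool"
  where "cstar_seminorm G N \<longleftrightarrow>
    (\<forall>p\<in>star_polys G. \<forall>q\<in>star_polys G. N (p + q) \<le> N p + N q) \<and>
    (\<forall>c. \<forall>p\<in>star_polys G. N (poly_scale c p) = cmod c * N p) \<and>
    (\<forall>p\<in>star_polys G. \<forall>q\<in>star_polys G. N (p * q) \<le> N p * N q) \<and>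
    (\<forall>p\<in>star_polys G. N (poly_adj p * p) = (N p)\<^sup>2)"

text \<open>
  A presentation consists of a set \<open>G\<close> of generators and a set \<open>Q\<close> of relations, where
  \<open>(p, q) \<in> Q\<close> stands for the equation \<open>p = q\<close>. C*-seminorms that respect the relations are the same
  as *-homomorphisms with dense range from the *-polynomials to a C*-algebra in which the relations
  hold. The universal C*-algebra is the completion of the *-polynomials for the largest
  such seminorm (which exists if the values of these seminorms on each generator are bounded).
\<close>

definition rel_seminorms :: "'g set \<Rightarrow> ('g star_poly \<times> 'g star_poly) set \<Rightarrow> ('g star_poly \<Rightarrow> real) set"
  where "rel_seminorms G Q = {N. cstar_seminorm G N \<and> (\<forall>(p, q)\<in>Q. N (p - q) = 0)}"

definition univ_norm :: "'g set \<Rightarrow> ('g star_poly \<times> 'g star_poly) set \<Rightarrow> 'g star_poly \<Rightarrow> real"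
  where "univ_norm G Q p = (SUP N\<in>rel_seminorms G Q. N p)"

definition cauchy_seqs ::
    "'g set \<Rightarrow> ('g star_poly \<times> 'g star_poly) set \<Rightarrow> (nat \<Rightarrow> 'g star_poly) set"
  where "cauchy_seqs G Q =
    {X. (\<forall>n. X n \<in> star_polys G) \<and>
        (\<forall>e>0. \<exists>k. \<forall>m\<ge>k. \<forall>n\<ge>k. univ_norm G Q (X m - X n) < e)}"

definition cauchy_class ::
    "'g set \<Rightarrow> ('g star_poly \<times> 'g star_poly) set \<Rightarrow> (nat \<Rightarrow> 'g star_poly)
      \<Rightarrow> (nat \<Rightarrow> 'g star_poly) set"
  where "cauchy_class G Q X =
    {Y \<in> cauchy_seqs G Q. (\<lambda>n. univ_norm G Q (X n - Y n)) \<longlonglongrightarrow> 0}"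

definition class_rep :: "(nat \<Rightarrow> 'g star_poly) set \<Rightarrow> nat \<Rightarrow> 'g star_poly"
  where "class_rep x = (SOME X. X \<in> x)"

definition univ_cstar ::
    "'g set \<Rightarrow> ('g star_poly \<times> 'g star_poly) set \<Rightarrow> (nat \<Rightarrow> 'g star_poly) set star_alg"
  where "univ_cstar G Q =
    \<lparr>carrier = cauchy_class G Q ` cauchy_seqs G Q,
     mult = (\<lambda>x y. cauchy_class G Q (\<lambda>n. class_rep x n * class_rep y n)),
     one = cauchy_class G Q (\<lambda>n. 1),
     zero = cauchy_class G Q (\<lambda>n. 0),
     add = (\<lambda>x y. cauchy_class G Q (\<lambda>n. class_rep x n + class_rep y n)),
     smult = (\<lambda>c x. cauchy_class G Q (\<lambda>n. poly_scale c (class_rep x n))),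
     adj = (\<lambda>x. cauchy_class G Q (\<lambda>n. poly_adj (class_rep x n))),
     nrm = (\<lambda>x. lim (\<lambda>n. univ_norm G Q (class_rep x n)))\<rparr>"

definition univ_gen ::
    "'g set \<Rightarrow> ('g star_poly \<times> 'g star_poly) set \<Rightarrow> 'g \<Rightarrow> (nat \<Rightarrow> 'g star_poly) set"
  where "univ_gen G Q g = cauchy_class G Q (\<lambda>n. poly_gen g)"


subsection \<open>C*-seminorms\<close>

context
  fixes G :: "'g set" and N :: "'g star_poly \<Rightarrow> real"
  assumes N: "cstar_seminorm G N"
begin

lemma seminorm_add: "p \<in> star_polys G \<Longrightarrow> q \<in> star_polys G \<Longrightarrow> N (p + q) \<le> N p + N q"
  and seminorm_scale: "p \<in> star_polys G \<Longrightarrow> N (poly_scale c p) = cmod c * N p"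
  and seminorm_mult: "p \<in> star_polys G \<Longrightarrow> q \<in> star_polys G \<Longrightarrow> N (p * q) \<le> N p * N q"
  and seminorm_cstar: "p \<in> star_polys G \<Longrightarrow> N (poly_adj p * p) = (N p)\<^sup>2"
  using N unfolding cstar_seminorm_def by blast+

lemma seminorm_uminus: "p \<in> star_polys G \<Longrightarrow> N (- p) = N p"
  using seminorm_scale[of p "-1"] by (simp add: poly_scale_minus_one)

lemma seminorm_zero: "N 0 = 0"
  using seminorm_scale[of 0 0] by (simp add: star_polys_zero poly_scale_zero)

lemma seminorm_nonneg: "p \<in> star_polys G \<Longrightarrow> 0 \<le> N p"
  using seminorm_add[of p "-p"] by (simp add: seminorm_uminus star_polys_uminus seminorm_zero)

lemma seminorm_diff: "p \<in> star_polys G \<Longrightarrow> q \<in> star_polys G \<Longrightarrow> N (p - q) \<le> N p + N q"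
  using seminorm_add[of p "-q"] by (simp add: seminorm_uminus star_polys_uminus)

lemma seminorm_minus_commute: "p \<in> star_polys G \<Longrightarrow> q \<in> star_polys G \<Longrightarrow> N (p - q) = N (q - p)"
  using seminorm_uminus[of "p - q"] by (simp add: star_polys_diff)

lemma seminorm_triangle_sub: "p \<in> star_polys G \<Longrightarrow> q \<in> star_polys G \<Longrightarrow> \<bar>N p - N q\<bar> \<le> N (p - q)"
  using seminorm_add[of "p - q" q] seminorm_add[of "q - p" p] seminorm_minus_commute[of p q]
  by (simp add: star_polys_diff)

lemma seminorm_adj: assumes p: "p \<in> star_polys G" shows "N (poly_adj p) = N p"
proof -
  have *: "N q \<le> N (poly_adj q)" if q: "q \<in> star_polys G" for q
  proof (cases "N q = 0")
    case True
    then show ?thesis using seminorm_nonneg[OF star_polys_adj[OF q]] by simp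
  next
    case False
    then have "0 < N q" using seminorm_nonneg[OF q] by simp
    moreover have "N q * N q \<le> N (poly_adj q) * N q"
      using seminorm_mult[OF star_polys_adj[OF q] q] seminorm_cstar[OF q] by (simp add: power2_eq_square)
    ultimately show ?thesis by simp
  qed
  show ?thesis using *[OF p] *[OF star_polys_adj[OF p]] by simp
qed

lemma seminorm_one: "N 1 \<le> 1"
proof -
  have "N 1 = (N 1)\<^sup>2" using seminorm_cstar[OF star_polys_one] by simp
  then show ?thesis by (metis power2_eq_square mult_cancel_right1 order_refl zero_le_one)
qed

lemma seminorm_isometry_le:
  assumes "p \<in> star_polys G" "N (poly_adj p * p - 1) = 0"
  shows "N p \<le> 1"
proof -
  have "(N p)\<^sup>2 \<le> N (poly_adj p * p - 1) + N 1"
    using seminorm_add[of "poly_adj p * p - 1" 1] assms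
    by (simp add: seminorm_cstar star_polys_intros)
  then have "(N p)\<^sup>2 \<le> 1" using assms seminorm_one by simp
  then show ?thesis using power2_le_imp_le[of "N p" 1] by simp
qed

lemma seminorm_projection_le:
  assumes "p \<in> star_polys G" "N (poly_adj p - p) = 0" "N (p * p - p) = 0"
  shows "N p \<le> 1"
proof -
  have "N ((poly_adj p - p) * p) \<le> N (poly_adj p - p) * N p"
    using assms by (intro seminorm_mult star_polys_intros) auto
  then have "N ((poly_adj p - p) * p) = 0"
    using assms seminorm_nonneg[of "(poly_adj p - p) * p"] by (simp add: star_polys_intros)
  moreover have "(N p)\<^sup>2 \<le> N ((poly_adj p - p) * p + (p * p - p)) + N p"
    using seminorm_add[of "(poly_adj p - p) * p + (p * p - p)" p] assms
    by (simp add: left_diff_distrib seminorm_cstar star_polys_intros)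
  moreover have "N ((poly_adj p - p) * p + (p * p - p)) \<le> N ((poly_adj p - p) * p) + N (p * p - p)"
    using assms by (intro seminorm_add star_polys_intros) auto
  ultimately have "(N p)\<^sup>2 \<le> N p" using assms by simp
  then show ?thesis
    by (metis linorder_not_le mult.right_neutral mult_less_cancel_left_pos order_less_trans power2_eq_square zero_less_one)
qed

end

subsection \<open>The universal C*-algebra of a presentation is a C*-algebra\<close>

locale presentation =
  fixes G :: "'g set" and Q :: "('g star_poly \<times> 'g star_poly) set"
  assumes bounded_gens: "\<And>g. g \<in> G \<Longrightarrow> \<exists>b. \<forall>N\<in>rel_seminorms G Q. N (poly_gen g) \<le> b"
begin

abbreviation "\<P> \<equiv> star_polys G"
abbreviation "\<N> \<equiv> univ_norm G Q"
abbreviation "\<C> \<equiv> cauchy_seqs G Q"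
abbreviation "cl \<equiv> cauchy_class G Q"
abbreviation "\<A> \<equiv> univ_cstar G Q"

lemma rel_seminorm: "N \<in> rel_seminorms G Q \<Longrightarrow> cstar_seminorm G N"
  by (simp add: rel_seminorms_def)

lemma zero_seminorm: "(\<lambda>p. 0) \<in> rel_seminorms G Q"
  by (auto simp: rel_seminorms_def cstar_seminorm_def)

lemma bounded_letter:
  assumes "fst l \<in> G"
  shows "\<exists>b. \<forall>N\<in>rel_seminorms G Q. N (Poly_Mapping.single (Word [l]) 1) \<le> b"
proof -
  obtain g s where l: "l = (g, s)" by force
  then have g: "g \<in> G" using assms by simp
  have "Poly_Mapping.single (Word [l]) 1 = (if s then poly_adj (poly_gen g) else poly_gen g)"
    by (simp add: l poly_gen_def poly_adj_single word_adj_def)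
  moreover have "N (poly_adj (poly_gen g)) = N (poly_gen g)" if "N \<in> rel_seminorms G Q" for N
    using that g by (intro seminorm_adj[OF rel_seminorm]) (auto intro: star_polys_intros)
  ultimately have "N (Poly_Mapping.single (Word [l]) 1) = N (poly_gen g)"
    if "N \<in> rel_seminorms G Q" for N using that by simp
  then show ?thesis using bounded_gens[OF g] by metis
qed

lemma bounded_word:
  "fst ` set ls \<subseteq> G \<Longrightarrow> \<exists>b. \<forall>N\<in>rel_seminorms G Q. N (Poly_Mapping.single (Word ls) 1) \<le> b"
proof (induction ls)
  case Nil
  have "N (Poly_Mapping.single (Word []) 1) \<le> 1" if "N \<in> rel_seminorms G Q" for N
    using seminorm_one[OF rel_seminorm[OF that]] by (simp add: zero_word_def[symmetric])
  then show ?case by blast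
next
  case (Cons l ls)
  then obtain b1 where b1: "\<And>N. N\<in>rel_seminorms G Q \<Longrightarrow> N (Poly_Mapping.single (Word ls) 1) \<le> b1" by auto
  obtain b2 where b2: "\<And>N. N\<in>rel_seminorms G Q \<Longrightarrow> N (Poly_Mapping.single (Word [l]) 1) \<le> b2"
    using bounded_letter[of l] Cons.prems by auto
  have "N (Poly_Mapping.single (Word (l # ls)) 1) \<le> b2 * b1" if N: "N \<in> rel_seminorms G Q" for N
  proof -
    have "fst l \<in> G" "fst ` set ls \<subseteq> G" using Cons.prems by auto
    then have p: "Poly_Mapping.single (Word [l]) 1 \<in> \<P>" "Poly_Mapping.single (Word ls) 1 \<in> \<P>"
      by (simp_all add: star_polys_single)
    have "N (Poly_Mapping.single (Word (l # ls)) 1) =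
        N (Poly_Mapping.single (Word [l]) 1 * Poly_Mapping.single (Word ls) 1)"
      by (simp add: mult_single plus_word_def)
    also have "\<dots> \<le> N (Poly_Mapping.single (Word [l]) 1) * N (Poly_Mapping.single (Word ls) 1)"
      by (rule seminorm_mult[OF rel_seminorm[OF N] p])
    also have "\<dots> \<le> b2 * b1"
      using b1[OF N] b2[OF N] seminorm_nonneg[OF rel_seminorm[OF N] p(1)]
        seminorm_nonneg[OF rel_seminorm[OF N] p(2)] by (intro mult_mono) auto
    finally show ?thesis .
  qed
  then show ?case by blast
qed

lemma bounded_poly: "p \<in> \<P> \<Longrightarrow> \<exists>b. \<forall>N\<in>rel_seminorms G Q. N p \<le> b"
proof (induction rule: star_polys_induct)
  case zero
  then show ?case using seminorm_zero[OF rel_seminorm] by (metis order_refl)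
next
  case (single_add w c q)
  then obtain b1 where b1: "\<And>N. N\<in>rel_seminorms G Q \<Longrightarrow> N q \<le> b1" by auto
  obtain b2 where b2: "\<And>N. N\<in>rel_seminorms G Q \<Longrightarrow> N (Poly_Mapping.single w 1) \<le> b2"
    using bounded_word[of "letters w"] single_add by auto
  have "N (Poly_Mapping.single w c + q) \<le> cmod c * b2 + b1" if N: "N \<in> rel_seminorms G Q" for N
  proof -
    have "N (Poly_Mapping.single w c + q) \<le> N (poly_scale c (Poly_Mapping.single w 1)) + N q"
      using single_add seminorm_add[OF rel_seminorm[OF N]]
      by (simp add: poly_scale_single star_polys_single)
    also have "\<dots> = cmod c * N (Poly_Mapping.single w 1) + N q"
      using single_add seminorm_scale[OF rel_seminorm[OF N]] by (simp add: star_polys_single)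
    also have "\<dots> \<le> cmod c * b2 + b1"
      using b1[OF N] b2[OF N] by (intro add_mono mult_left_mono) auto
    finally show ?thesis .
  qed
  then show ?case by blast
qed

lemma le_univ_norm: "N \<in> rel_seminorms G Q \<Longrightarrow> p \<in> \<P> \<Longrightarrow> N p \<le> \<N> p"
  unfolding univ_norm_def using bounded_poly[of p] by (intro cSUP_upper) (auto simp: bdd_above_def)

lemma univ_norm_least: "(\<And>N. N \<in> rel_seminorms G Q \<Longrightarrow> N p \<le> b) \<Longrightarrow> \<N> p \<le> b"
  unfolding univ_norm_def using zero_seminorm by (intro cSUP_least) auto

lemma univ_norm_nonneg': "p \<in> \<P> \<Longrightarrow> 0 \<le> \<N> p"
  using le_univ_norm[OF zero_seminorm] by simp

lemma univ_seminorm: "cstar_seminorm G \<N>"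
  unfolding cstar_seminorm_def
proof (intro conjI ballI allI)
  fix p q assume p: "p \<in> \<P>" and q: "q \<in> \<P>"
  show "\<N> (p + q) \<le> \<N> p + \<N> q"
  proof (rule univ_norm_least)
    fix N assume N: "N \<in> rel_seminorms G Q"
    show "N (p + q) \<le> \<N> p + \<N> q"
      using seminorm_add[OF rel_seminorm[OF N] p q] le_univ_norm[OF N p] le_univ_norm[OF N q] by simp
  qed
  show "\<N> (p * q) \<le> \<N> p * \<N> q"
  proof (rule univ_norm_least)
    fix N assume N: "N \<in> rel_seminorms G Q"
    show "N (p * q) \<le> \<N> p * \<N> q"
      by (rule order_trans[OF seminorm_mult[OF rel_seminorm[OF N] p q]])
        (intro mult_mono le_univ_norm N p q univ_norm_nonneg' seminorm_nonneg[OF rel_seminorm[OF N]])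
  qed
next
  fix c p assume p: "p \<in> \<P>"
  have *: "\<N> (poly_scale d q) \<le> cmod d * \<N> q" if q: "q \<in> \<P>" for d q
    by (rule univ_norm_least)
      (simp add: seminorm_scale[OF rel_seminorm] q mult_left_mono le_univ_norm)
  show "\<N> (poly_scale c p) = cmod c * \<N> p"
  proof (cases "c = 0")
    case True
    then show ?thesis
      using *[OF p, of c] univ_norm_nonneg'[OF star_polys_scale[OF p], of c] by simp
  next
    case False
    then have "\<N> p \<le> cmod (1 / c) * \<N> (poly_scale c p)"
      using *[OF star_polys_scale[OF p], of "1/c" c] by (simp add: poly_scale_scale poly_scale_one)
    then have "cmod c * \<N> p \<le> \<N> (poly_scale c p)"
      using False by (simp add: norm_divide field_simps)
    then show ?thesis using *[OF p, of c] by simp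
  qed
next
  fix p assume p: "p \<in> \<P>"
  show "\<N> (poly_adj p * p) = (\<N> p)\<^sup>2"
  proof (rule antisym)
    show "\<N> (poly_adj p * p) \<le> (\<N> p)\<^sup>2"
    proof (rule univ_norm_least)
      fix N assume N: "N \<in> rel_seminorms G Q"
      show "N (poly_adj p * p) \<le> (\<N> p)\<^sup>2"
        by (simp add: seminorm_cstar[OF rel_seminorm[OF N] p] power_mono le_univ_norm[OF N p]
            seminorm_nonneg[OF rel_seminorm[OF N] p])
    qed
    have pp: "poly_adj p * p \<in> \<P>" using p by (intro star_polys_intros)
    have "\<N> p \<le> sqrt (\<N> (poly_adj p * p))"
    proof (rule univ_norm_least)
      fix N assume N: "N \<in> rel_seminorms G Q"
      have "(N p)\<^sup>2 \<le> \<N> (poly_adj p * p)"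
        using le_univ_norm[OF N pp] by (simp add: seminorm_cstar[OF rel_seminorm[OF N] p])
      then show "N p \<le> sqrt (\<N> (poly_adj p * p))" by (rule real_le_rsqrt)
    qed
    then show "(\<N> p)\<^sup>2 \<le> \<N> (poly_adj p * p)"
      using univ_norm_nonneg'[OF p] univ_norm_nonneg'[OF pp] by (metis power_mono real_sqrt_pow2)
  qed
qed

lemmas univ_add = seminorm_add[OF univ_seminorm]
  and univ_scale = seminorm_scale[OF univ_seminorm]
  and univ_mult = seminorm_mult[OF univ_seminorm]
  and univ_cstar = seminorm_cstar[OF univ_seminorm]
  and univ_zero = seminorm_zero[OF univ_seminorm]
  and univ_nonneg = seminorm_nonneg[OF univ_seminorm]
  and univ_diff = seminorm_diff[OF univ_seminorm]
  and univ_minus_commute = seminorm_minus_commute[OF univ_seminorm]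
  and univ_triangle_sub = seminorm_triangle_sub[OF univ_seminorm]
  and univ_adj = seminorm_adj[OF univ_seminorm]
  and univ_one = seminorm_one[OF univ_seminorm]

lemma univ_rel: assumes "(p, q) \<in> Q" "p \<in> \<P>" "q \<in> \<P>" shows "\<N> (p - q) = 0"
proof (rule antisym)
  show "\<N> (p - q) \<le> 0"
    using assms(1) by (intro univ_norm_least) (auto simp: rel_seminorms_def)
  show "0 \<le> \<N> (p - q)" using assms by (intro univ_nonneg star_polys_diff)
qed

lemma univ_in_rel_seminorms: "Q \<subseteq> \<P> \<times> \<P> \<Longrightarrow> \<N> \<in> rel_seminorms G Q"
  using univ_seminorm univ_rel by (fastforce simp: rel_seminorms_def)

lemma univ_diff_triangle:
  assumes "p \<in> \<P>" "q \<in> \<P>" "r \<in> \<P>" shows "\<N> (p - r) \<le> \<N> (p - q) + \<N> (q - r)"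
  using univ_add[of "p - q" "q - r"] assms by (simp add: star_polys_diff)

lemma cauchyD: "X \<in> \<C> \<Longrightarrow> X n \<in> \<P>"
  by (simp add: cauchy_seqs_def)

lemma cauchyE: "X \<in> \<C> \<Longrightarrow> e > 0 \<Longrightarrow> \<exists>k. \<forall>m\<ge>k. \<forall>n\<ge>k. \<N> (X m - X n) < e"
  by (simp add: cauchy_seqs_def)

lemma cauchy_const: "p \<in> \<P> \<Longrightarrow> (\<lambda>n. p) \<in> \<C>"
  by (simp add: cauchy_seqs_def univ_zero)

lemma cauchy_lipschitz:
  assumes X: "X \<in> \<C>" and f: "\<And>p. p \<in> \<P> \<Longrightarrow> f p \<in> \<P>"
    and L: "\<And>p q. p \<in> \<P> \<Longrightarrow> q \<in> \<P> \<Longrightarrow> \<N> (f p - f q) \<le> b * \<N> (p - q)"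
  shows "(\<lambda>n. f (X n)) \<in> \<C>"
proof -
  have "\<exists>k. \<forall>m\<ge>k. \<forall>n\<ge>k. \<N> (f (X m) - f (X n)) < e" if e: "e > 0" for e
  proof -
    define b' where "b' = \<bar>b\<bar> + 1"
    have b': "b' > 0" "b \<le> b'" by (auto simp: b'_def)
    then obtain k where k: "\<And>m n. m \<ge> k \<Longrightarrow> n \<ge> k \<Longrightarrow> \<N> (X m - X n) < e / b'"
      using cauchyE[OF X, of "e / b'"] e by auto
    have "\<N> (f (X m) - f (X n)) < e" if "m \<ge> k" "n \<ge> k" for m n
    proof -
      have "\<N> (f (X m) - f (X n)) \<le> b * \<N> (X m - X n)" using X by (intro L cauchyD)
      also have "\<dots> \<le> b' * \<N> (X m - X n)"
        using b' X by (intro mult_right_mono univ_nonneg star_polys_diff cauchyD)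
      also have "\<dots> < e" using k[OF that] b' by (simp add: field_simps)
      finally show ?thesis .
    qed
    then show ?thesis by blast
  qed
  then show ?thesis using X f by (simp add: cauchy_seqs_def)
qed

lemma cauchy_scale: "X \<in> \<C> \<Longrightarrow> (\<lambda>n. poly_scale c (X n)) \<in> \<C>"
  by (rule cauchy_lipschitz[where b = "cmod c"])
    (auto intro: star_polys_intros simp: poly_scale_diff[symmetric] univ_scale star_polys_diff)

lemma cauchy_adj: "X \<in> \<C> \<Longrightarrow> (\<lambda>n. poly_adj (X n)) \<in> \<C>"
  by (rule cauchy_lipschitz[where b = 1])
    (auto intro: star_polys_intros simp: poly_adj_diff[symmetric] univ_adj star_polys_diff)

lemma cauchy_bounded: assumes X: "X \<in> \<C>" shows "\<exists>b>0. \<forall>n. \<N> (X n) \<le> b"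
proof -
  obtain k where k: "\<And>m n. m \<ge> k \<Longrightarrow> n \<ge> k \<Longrightarrow> \<N> (X m - X n) < 1"
    using cauchyE[OF X, of 1] by auto
  define b where "b = 1 + (\<Sum>i\<le>k. \<N> (X i))"
  have nn: "0 \<le> \<N> (X i)" for i using X by (intro univ_nonneg cauchyD)
  have le: "\<N> (X i) \<le> b - 1" if "i \<le> k" for i
    unfolding b_def using member_le_sum[of i "{..k}" "\<lambda>i. \<N> (X i)"] nn that by simp
  have "\<N> (X n) \<le> b" for n
  proof (cases "n \<le> k")
    case True then show ?thesis using le[of n] by simp
  next
    case False
    then have "\<N> (X n - X k) < 1" using k by simp
    moreover have "\<N> (X n) \<le> \<N> (X n - X k) + \<N> (X k)"
      using univ_add[of "X n - X k" "X k"] X by (simp add: star_polys_diff cauchyD)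
    ultimately show ?thesis using le[of k] by simp
  qed
  moreover have "b > 0" using nn by (simp add: b_def add_pos_nonneg sum_nonneg)
  ultimately show ?thesis by blast
qed

lemma cauchy_add: assumes X: "X \<in> \<C>" and Y: "Y \<in> \<C>" shows "(\<lambda>n. X n + Y n) \<in> \<C>"
proof -
  have "\<exists>k. \<forall>m\<ge>k. \<forall>n\<ge>k. \<N> (X m + Y m - (X n + Y n)) < e" if e: "e > 0" for e
  proof -
    obtain k where k: "\<And>m n. m \<ge> k \<Longrightarrow> n \<ge> k \<Longrightarrow> \<N> (X m - X n) < e/2"
      using cauchyE[OF X, of "e/2"] e by auto
    obtain l where l: "\<And>m n. m \<ge> l \<Longrightarrow> n \<ge> l \<Longrightarrow> \<N> (Y m - Y n) < e/2"
      using cauchyE[OF Y, of "e/2"] e by auto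
    have "\<N> (X m + Y m - (X n + Y n)) < e" if "m \<ge> max k l" "n \<ge> max k l" for m n
      using univ_add[of "X m - X n" "Y m - Y n"] k[of m n] l[of m n] that X Y
      by (simp add: star_polys_diff cauchyD add_diff_add)
    then show ?thesis by blast
  qed
  then show ?thesis using X Y by (simp add: cauchy_seqs_def star_polys_add)
qed

lemma univ_mult_diff:
  assumes "p \<in> \<P>" "q \<in> \<P>" "r \<in> \<P>" "s \<in> \<P>"
  shows "\<N> (p * q - r * s) \<le> \<N> p * \<N> (q - s) + \<N> (p - r) * \<N> s"
proof -
  have "p * q - r * s = p * (q - s) + (p - r) * s" by (simp add: algebra_simps)
  then have "\<N> (p * q - r * s) \<le> \<N> (p * (q - s)) + \<N> ((p - r) * s)"
    using univ_add[of "p * (q - s)" "(p - r) * s"] assms by (simp add: star_polys_intros)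
  then show ?thesis
    using univ_mult[of p "q - s"] univ_mult[of "p - r" s] assms by (simp add: star_polys_diff)
qed

lemma cauchy_mult: assumes X: "X \<in> \<C>" and Y: "Y \<in> \<C>" shows "(\<lambda>n. X n * Y n) \<in> \<C>"
proof -
  obtain b where b: "b > 0" "\<And>n. \<N> (X n) \<le> b" using cauchy_bounded[OF X] by auto
  obtain c where c: "c > 0" "\<And>n. \<N> (Y n) \<le> c" using cauchy_bounded[OF Y] by auto
  have "\<exists>k. \<forall>m\<ge>k. \<forall>n\<ge>k. \<N> (X m * Y m - (X n * Y n)) < e" if e: "e > 0" for e
  proof -
    obtain k where k: "\<And>m n. m \<ge> k \<Longrightarrow> n \<ge> k \<Longrightarrow> \<N> (X m - X n) < e / (2 * c)"
      using cauchyE[OF X, of "e / (2 * c)"] e c by auto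
    obtain l where l: "\<And>m n. m \<ge> l \<Longrightarrow> n \<ge> l \<Longrightarrow> \<N> (Y m - Y n) < e / (2 * b)"
      using cauchyE[OF Y, of "e / (2 * b)"] e b by auto
    have "\<N> (X m * Y m - (X n * Y n)) < e" if mn: "m \<ge> max k l" "n \<ge> max k l" for m n
    proof -
      have "\<N> (X m * Y m - (X n * Y n)) \<le> \<N> (X m) * \<N> (Y m - Y n) + \<N> (X m - X n) * \<N> (Y n)"
        using X Y by (intro univ_mult_diff cauchyD)
      also have "\<dots> \<le> b * \<N> (Y m - Y n) + \<N> (X m - X n) * c"
        using X Y b c by (intro add_mono mult_mono univ_nonneg star_polys_diff cauchyD) auto
      also have "\<dots> < b * (e / (2 * b)) + e / (2 * c) * c"
        using k[of m n] l[of m n] mn b c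
        by (intro add_strict_mono mult_strict_left_mono mult_strict_right_mono) auto
      also have "\<dots> = e" using b c by simp
      finally show ?thesis .
    qed
    then show ?thesis by blast
  qed
  then show ?thesis using X Y by (simp add: cauchy_seqs_def star_polys_mult)
qed

text \<open>Equality of classes and the operations on representatives.\<close>

definition eqv where "eqv X Y \<longleftrightarrow> (\<lambda>n. \<N> (X n - Y n)) \<longlonglongrightarrow> 0"

lemma eqv_refl: "eqv X X"
  by (simp add: eqv_def univ_zero)

lemma eqv_sym: "X \<in> \<C> \<Longrightarrow> Y \<in> \<C> \<Longrightarrow> eqv X Y \<Longrightarrow> eqv Y X"
  by (simp add: eqv_def univ_minus_commute[OF cauchyD cauchyD])

lemma eqv_le:
  assumes "f \<longlonglongrightarrow> 0" "\<And>n. X n \<in> \<P>" "\<And>n. Y n \<in> \<P>" "\<And>n. \<N> (X n - Y n) \<le> f n" shows "eqv X Y"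
  unfolding eqv_def
  by (rule tendsto_sandwich[OF _ _ tendsto_const assms(1)])
    (auto intro!: always_eventually univ_nonneg star_polys_diff assms)

lemma eqv_trans:
  assumes "X \<in> \<C>" "Y \<in> \<C>" "Z \<in> \<C>" "eqv X Y" "eqv Y Z" shows "eqv X Z"
proof (rule eqv_le)
  show "(\<lambda>n. \<N> (X n - Y n) + \<N> (Y n - Z n)) \<longlonglongrightarrow> 0"
    using tendsto_add[OF assms(4,5)[unfolded eqv_def]] by simp
qed (auto intro!: univ_diff_triangle cauchyD assms)

lemma cl_eq_iff: assumes "X \<in> \<C>" "Y \<in> \<C>" shows "cl X = cl Y \<longleftrightarrow> eqv X Y"
proof -
  have cl: "cl Z = {W \<in> \<C>. eqv Z W}" for Z by (simp add: cauchy_class_def eqv_def)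
  show ?thesis unfolding cl using assms
    by (auto simp: set_eq_iff intro: eqv_refl eqv_sym eqv_trans)
qed

lemma class_rep: assumes "X \<in> \<C>"
  shows "class_rep (cl X) \<in> \<C>" "eqv X (class_rep (cl X))" "eqv (class_rep (cl X)) X"
proof -
  have "X \<in> cl X" using assms eqv_refl by (simp add: cauchy_class_def eqv_def)
  then have "class_rep (cl X) \<in> cl X" unfolding class_rep_def
    using someI[of "\<lambda>Y. Y \<in> cl X" X] by blast
  then show *: "class_rep (cl X) \<in> \<C>" "eqv X (class_rep (cl X))"
    by (auto simp: cauchy_class_def eqv_def)
  show "eqv (class_rep (cl X)) X" by (rule eqv_sym[OF assms *])
qed

lemma carrier_univ: "carrier \<A> = cl ` \<C>"
  by (simp add: univ_cstar_def)

lemma carrierI: "X \<in> \<C> \<Longrightarrow> cl X \<in> carrier \<A>"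
  by (simp add: carrier_univ)

lemma carrierE: assumes "x \<in> carrier \<A>" obtains X where "X \<in> \<C>" "x = cl X"
  using assms by (auto simp: carrier_univ)

lemma eqv_add: assumes "X \<in> \<C>" "Y \<in> \<C>" "X' \<in> \<C>" "Y' \<in> \<C>" "eqv X X'" "eqv Y Y'"
  shows "eqv (\<lambda>n. X n + Y n) (\<lambda>n. X' n + Y' n)"
proof (rule eqv_le)
  show "(\<lambda>n. \<N> (X n - X' n) + \<N> (Y n - Y' n)) \<longlonglongrightarrow> 0"
    using tendsto_add[OF assms(5,6)[unfolded eqv_def]] by simp
  show "\<N> (X n + Y n - (X' n + Y' n)) \<le> \<N> (X n - X' n) + \<N> (Y n - Y' n)" for n
    using univ_add[of "X n - X' n" "Y n - Y' n"] assms by (simp add: add_diff_add star_polys_diff cauchyD)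
qed (simp_all add: star_polys_add cauchyD assms)

lemma eqv_mult: assumes "X \<in> \<C>" "Y \<in> \<C>" "X' \<in> \<C>" "Y' \<in> \<C>" "eqv X X'" "eqv Y Y'"
  shows "eqv (\<lambda>n. X n * Y n) (\<lambda>n. X' n * Y' n)"
proof -
  obtain b where b: "\<And>n. \<N> (X n) \<le> b" using cauchy_bounded[OF assms(1)] by auto
  obtain c where c: "\<And>n. \<N> (Y' n) \<le> c" using cauchy_bounded[OF assms(4)] by auto
  show ?thesis
  proof (rule eqv_le)
    show "(\<lambda>n. b * \<N> (Y n - Y' n) + \<N> (X n - X' n) * c) \<longlonglongrightarrow> 0"
      using tendsto_add[OF tendsto_mult_left[OF assms(6)[unfolded eqv_def], of b]
          tendsto_mult_right[OF assms(5)[unfolded eqv_def], of c]] by simp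
    show "\<N> (X n * Y n - X' n * Y' n) \<le> b * \<N> (Y n - Y' n) + \<N> (X n - X' n) * c" for n
    proof -
      have "\<N> (X n * Y n - X' n * Y' n) \<le> \<N> (X n) * \<N> (Y n - Y' n) + \<N> (X n - X' n) * \<N> (Y' n)"
        using assms by (intro univ_mult_diff cauchyD)
      also have "\<dots> \<le> b * \<N> (Y n - Y' n) + \<N> (X n - X' n) * c"
        using b c assms
        by (intro add_mono mult_right_mono mult_left_mono univ_nonneg star_polys_diff cauchyD) auto
      finally show ?thesis .
    qed
  qed (simp_all add: star_polys_mult cauchyD assms)
qed

lemma eqv_scale: assumes "X \<in> \<C>" "X' \<in> \<C>" "eqv X X'"
  shows "eqv (\<lambda>n. poly_scale c (X n)) (\<lambda>n. poly_scale c (X' n))"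
  using tendsto_mult_left[OF assms(3)[unfolded eqv_def], of "cmod c"] assms
  by (simp add: eqv_def poly_scale_diff[symmetric] univ_scale star_polys_diff cauchyD)

lemma eqv_adj: assumes "X \<in> \<C>" "X' \<in> \<C>" "eqv X X'"
  shows "eqv (\<lambda>n. poly_adj (X n)) (\<lambda>n. poly_adj (X' n))"
  using assms by (simp add: eqv_def poly_adj_diff[symmetric] univ_adj star_polys_diff cauchyD)

lemma univ_add_cl: "X \<in> \<C> \<Longrightarrow> Y \<in> \<C> \<Longrightarrow> cl X \<oplus>\<^bsub>\<A>\<^esub> cl Y = cl (\<lambda>n. X n + Y n)"
  by (simp add: univ_cstar_def cl_eq_iff cauchy_add class_rep)
    (rule eqv_add; simp add: class_rep)

lemma univ_mult_cl: "X \<in> \<C> \<Longrightarrow> Y \<in> \<C> \<Longrightarrow> cl X \<otimes>\<^bsub>\<A>\<^esub> cl Y = cl (\<lambda>n. X n * Y n)"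
  by (simp add: univ_cstar_def cl_eq_iff cauchy_mult class_rep)
    (rule eqv_mult; simp add: class_rep)

lemma univ_smult_cl: "X \<in> \<C> \<Longrightarrow> c \<odot>\<^bsub>\<A>\<^esub> cl X = cl (\<lambda>n. poly_scale c (X n))"
  by (simp add: univ_cstar_def cl_eq_iff cauchy_scale class_rep)
    (rule eqv_scale; simp add: class_rep)

lemma univ_adj_cl: "X \<in> \<C> \<Longrightarrow> adj \<A> (cl X) = cl (\<lambda>n. poly_adj (X n))"
  by (simp add: univ_cstar_def cl_eq_iff cauchy_adj class_rep)
    (rule eqv_adj; simp add: class_rep)

lemma univ_one_cl: "\<one>\<^bsub>\<A>\<^esub> = cl (\<lambda>n. 1)"
  by (simp add: univ_cstar_def)

lemma univ_zero_cl: "\<zero>\<^bsub>\<A>\<^esub> = cl (\<lambda>n. 0)"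
  by (simp add: univ_cstar_def)

lemma univ_norm_convergent: assumes X: "X \<in> \<C>" shows "convergent (\<lambda>n. \<N> (X n))"
proof -
  have "Cauchy (\<lambda>n. \<N> (X n))"
  proof (rule metric_CauchyI)
    fix e :: real assume "e > 0"
    then obtain k where k: "\<And>m n. m \<ge> k \<Longrightarrow> n \<ge> k \<Longrightarrow> \<N> (X m - X n) < e" using cauchyE[OF X] by blast
    have "dist (\<N> (X m)) (\<N> (X n)) < e" if "m \<ge> k" "n \<ge> k" for m n
      using univ_triangle_sub[of "X m" "X n"] k[OF that] X by (simp add: dist_real_def cauchyD)
    then show "\<exists>M. \<forall>m\<ge>M. \<forall>n\<ge>M. dist (\<N> (X m)) (\<N> (X n)) < e" by blast
  qed
  then show ?thesis by (rule Cauchy_convergent)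
qed

lemma univ_nrm_cl: assumes X: "X \<in> \<C>" shows "(\<lambda>n. \<N> (X n)) \<longlonglongrightarrow> nrm \<A> (cl X)"
proof -
  let ?Y = "class_rep (cl X)"
  note Y = class_rep[OF X]
  have "(\<lambda>n. \<N> (?Y n)) \<longlonglongrightarrow> nrm \<A> (cl X)"
    using univ_norm_convergent[OF Y(1)] by (simp add: univ_cstar_def convergent_LIMSEQ_iff)
  moreover have "(\<lambda>n. \<N> (X n) - \<N> (?Y n)) \<longlonglongrightarrow> 0"
  proof (rule tendsto_0_le[OF Y(2)[unfolded eqv_def], where K = 1])
    have "\<bar>\<N> (X n) - \<N> (?Y n)\<bar> \<le> \<bar>\<N> (X n - ?Y n)\<bar>" for n
      using univ_triangle_sub[of "X n" "?Y n"] X Y(1) by (simp add: cauchyD)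
    then show "\<forall>\<^sub>F n in sequentially. norm (\<N> (X n) - \<N> (?Y n)) \<le> norm (\<N> (X n - ?Y n)) * 1"
      by simp
  qed
  ultimately show ?thesis using tendsto_add by fastforce
qed

lemma univ_ring: "ring \<A>"
proof (rule ringI)
  show "abelian_group \<A>"
  proof (rule abelian_groupI)
    fix x assume "x \<in> carrier \<A>"
    then obtain X where X: "X \<in> \<C>" "x = cl X" by (rule carrierE)
    have "(\<lambda>n. - X n) \<in> \<C>" using cauchy_scale[OF X(1), of "-1"] by (simp add: poly_scale_minus_one)
    then show "\<exists>y\<in>carrier \<A>. y \<oplus>\<^bsub>\<A>\<^esub> x = \<zero>\<^bsub>\<A>\<^esub>"
      using X by (intro bexI[of _ "cl (\<lambda>n. - X n)"]) (auto simp: univ_add_cl univ_zero_cl carrierI)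
  qed (auto elim!: carrierE simp: univ_add_cl univ_zero_cl cauchy_add cauchy_const star_polys_zero
      carrierI add_ac)
  show "monoid \<A>"
    by (rule monoidI) (auto elim!: carrierE simp: univ_mult_cl univ_one_cl cauchy_mult cauchy_const
        star_polys_one carrierI mult.assoc)
qed (auto elim!: carrierE simp: univ_add_cl univ_mult_cl cauchy_add cauchy_mult distrib_left distrib_right)

lemma univ_minus_cl: assumes "X \<in> \<C>" "Y \<in> \<C>" shows "cl X \<ominus>\<^bsub>\<A>\<^esub> cl Y = cl (\<lambda>n. X n - Y n)"
proof -
  interpret ring \<A> by (rule univ_ring)
  have m: "(\<lambda>n. - Y n) \<in> \<C>" using cauchy_scale[OF assms(2), of "-1"] by (simp add: poly_scale_minus_one)
  have "\<ominus>\<^bsub>\<A>\<^esub> cl Y = cl (\<lambda>n. - Y n)"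
    by (rule minus_equality) (use assms m in \<open>auto simp: univ_add_cl univ_zero_cl carrierI\<close>)
  then show ?thesis using assms m by (simp add: a_minus_def univ_add_cl)
qed

lemma univ_module: "module complex_ring \<A>"
proof (rule moduleI)
  show "cring complex_ring"
    by (rule cringI, rule abelian_groupI)
      (auto simp: complex_ring_def algebra_simps intro: exI[of _ "- x" for x] intro!: comm_monoidI)
  show "abelian_group \<A>" using univ_ring by (rule ring.is_abelian_group)
qed (auto elim!: carrierE simp: complex_ring_def univ_add_cl univ_smult_cl cauchy_add cauchy_scale
    carrierI poly_scale_add_left poly_scale_add_right poly_scale_scale poly_scale_one)

lemma univ_complete:
  assumes x: "\<And>n. x n \<in> carrier \<A>"
    and cau: "\<And>e. e > 0 \<Longrightarrow> \<exists>k. \<forall>m\<ge>k. \<forall>n\<ge>k. nrm \<A> (x m \<ominus>\<^bsub>\<A>\<^esub> x n) < e"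
  shows "\<exists>l\<in>carrier \<A>. (\<lambda>n. nrm \<A> (x n \<ominus>\<^bsub>\<A>\<^esub> l)) \<longlonglongrightarrow> 0"
proof -
  have "\<forall>n. \<exists>X. X \<in> \<C> \<and> x n = cl X" using x by (meson carrierE)
  then obtain X where X: "\<And>n. X n \<in> \<C>" "\<And>n. x n = cl (X n)" by metis
  have nrm_lim: "(\<lambda>i. \<N> (Y i - Z i)) \<longlonglongrightarrow> nrm \<A> (cl Y \<ominus>\<^bsub>\<A>\<^esub> cl Z)" if "Y \<in> \<C>" "Z \<in> \<C>" for Y Z
  proof -
    have "(\<lambda>n. Y n - Z n) \<in> \<C>"
      using cauchy_add[OF that(1) cauchy_scale[OF that(2), of "-1"]] by (simp add: poly_scale_minus_one)
    then show ?thesis using univ_nrm_cl that by (simp add: univ_minus_cl)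
  qed
  have "\<exists>p\<in>\<P>. nrm \<A> (cl (X n) \<ominus>\<^bsub>\<A>\<^esub> cl (\<lambda>i. p)) \<le> inverse (real (Suc n))" for n
  proof -
    have "0 < inverse (real (Suc n))" by simp
    from cauchyE[OF X(1) this, of n]
    obtain k where k: "\<And>i j. i \<ge> k \<Longrightarrow> j \<ge> k \<Longrightarrow> \<N> (X n i - X n j) < inverse (real (Suc n))"
      by blast
    have "(\<lambda>i. \<N> (X n i - X n k)) \<longlonglongrightarrow> nrm \<A> (cl (X n) \<ominus>\<^bsub>\<A>\<^esub> cl (\<lambda>i. X n k))"
      by (intro nrm_lim X cauchy_const cauchyD)
    then have "nrm \<A> (cl (X n) \<ominus>\<^bsub>\<A>\<^esub> cl (\<lambda>i. X n k)) \<le> inverse (real (Suc n))"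
      by (rule Lim_bounded[of _ _ k]) (use k in \<open>auto intro: less_imp_le\<close>)
    then show ?thesis using cauchyD[OF X(1)] by blast
  qed
  then obtain p where p: "\<And>n. p n \<in> \<P>"
    "\<And>n. nrm \<A> (x n \<ominus>\<^bsub>\<A>\<^esub> cl (\<lambda>i. p n)) \<le> inverse (real (Suc n))" unfolding X(2) by metis
  have tri: "nrm \<A> (cl Y \<ominus>\<^bsub>\<A>\<^esub> cl W) \<le> nrm \<A> (cl Y \<ominus>\<^bsub>\<A>\<^esub> cl Z) + nrm \<A> (cl Z \<ominus>\<^bsub>\<A>\<^esub> cl W)"
    if "Y \<in> \<C>" "Z \<in> \<C>" "W \<in> \<C>" for Y Z W
    by (rule LIMSEQ_le[OF nrm_lim tendsto_add[OF nrm_lim nrm_lim]])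
      (use that in \<open>auto intro!: univ_diff_triangle cauchyD\<close>)
  have comm: "nrm \<A> (cl Y \<ominus>\<^bsub>\<A>\<^esub> cl Z) = nrm \<A> (cl Z \<ominus>\<^bsub>\<A>\<^esub> cl Y)" if "Y \<in> \<C>" "Z \<in> \<C>" for Y Z
  proof (rule LIMSEQ_unique[OF nrm_lim[OF that]])
    have "\<N> (Y i - Z i) = \<N> (Z i - Y i)" for i by (intro univ_minus_commute cauchyD that)
    then show "(\<lambda>i. \<N> (Y i - Z i)) \<longlonglongrightarrow> nrm \<A> (cl Z \<ominus>\<^bsub>\<A>\<^esub> cl Y)"
      using nrm_lim[OF that(2,1)] by simp
  qed
  have const: "nrm \<A> (cl (\<lambda>i. q) \<ominus>\<^bsub>\<A>\<^esub> cl (\<lambda>i. r)) = \<N> (q - r)" if "q \<in> \<P>" "r \<in> \<P>" for q r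
    using nrm_lim[OF cauchy_const cauchy_const, OF that] by (simp add: LIMSEQ_const_iff)
  have pC: "p \<in> \<C>"
    unfolding cauchy_seqs_def
  proof (intro CollectI conjI allI impI p)
    fix e :: real assume e: "e > 0"
    obtain k where k: "\<And>m n. m \<ge> k \<Longrightarrow> n \<ge> k \<Longrightarrow> nrm \<A> (x m \<ominus>\<^bsub>\<A>\<^esub> x n) < e/3"
      using cau[of "e/3"] e by auto
    obtain l where l: "inverse (real (Suc l)) < e/3" using reals_Archimedean[of "e/3"] e by auto
    have "\<N> (p m - p n) < e" if mn: "m \<ge> max k l" "n \<ge> max k l" for m n
    proof -
      have small: "inverse (real (Suc i)) < e/3" if "i \<ge> l" for i
        using that by (intro le_less_trans[OF _ l]) (simp add: field_simps)
      have "\<N> (p m - p n) \<le> nrm \<A> (cl (\<lambda>i. p m) \<ominus>\<^bsub>\<A>\<^esub> x m) +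
          (nrm \<A> (x m \<ominus>\<^bsub>\<A>\<^esub> x n) + nrm \<A> (x n \<ominus>\<^bsub>\<A>\<^esub> cl (\<lambda>i. p n)))"
        unfolding const[OF p(1) p(1), symmetric] X(2)
        using tri[OF cauchy_const[OF p(1)[of m]] X(1)[of m] cauchy_const[OF p(1)[of n]]]
          tri[OF X(1)[of m] X(1)[of n] cauchy_const[OF p(1)[of n]]] by linarith
      also have "nrm \<A> (cl (\<lambda>i. p m) \<ominus>\<^bsub>\<A>\<^esub> x m) = nrm \<A> (x m \<ominus>\<^bsub>\<A>\<^esub> cl (\<lambda>i. p m))"
        unfolding X(2) by (rule comm[OF cauchy_const[OF p(1)] X(1)])
      finally show ?thesis using p(2)[of m] p(2)[of n] small[of m] small[of n] k[of m n] mn by simp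
    qed
    then show "\<exists>k. \<forall>m\<ge>k. \<forall>n\<ge>k. \<N> (p m - p n) < e" by blast
  qed
  have "(\<lambda>n. nrm \<A> (cl (\<lambda>i. p n) \<ominus>\<^bsub>\<A>\<^esub> cl p)) \<longlonglongrightarrow> 0"
  proof (rule LIMSEQ_I)
    fix e :: real assume e: "e > 0"
    obtain k where k: "\<And>m n. m \<ge> k \<Longrightarrow> n \<ge> k \<Longrightarrow> \<N> (p m - p n) < e/2"
      using cauchyE[OF pC, of "e/2"] e by auto
    have "norm (nrm \<A> (cl (\<lambda>i. p n) \<ominus>\<^bsub>\<A>\<^esub> cl p) - 0) < e" if "n \<ge> k" for n
    proof -
      note lim = nrm_lim[OF cauchy_const[OF p(1)] pC, of n]
      have "nrm \<A> (cl (\<lambda>i. p n) \<ominus>\<^bsub>\<A>\<^esub> cl p) \<le> e/2"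
        by (rule Lim_bounded[OF lim, of k]) (use k that in \<open>auto intro: less_imp_le\<close>)
      moreover have "0 \<le> nrm \<A> (cl (\<lambda>i. p n) \<ominus>\<^bsub>\<A>\<^esub> cl p)"
        by (rule Lim_bounded2[OF lim, of 0]) (auto intro: univ_nonneg star_polys_diff p)
      ultimately show ?thesis using e by simp
    qed
    then show "\<exists>no. \<forall>n\<ge>no. norm (nrm \<A> (cl (\<lambda>i. p n) \<ominus>\<^bsub>\<A>\<^esub> cl p) - 0) < e" by blast
  qed
  from tendsto_add[OF LIMSEQ_inverse_real_of_nat this]
  have lim: "(\<lambda>n. inverse (real (Suc n)) + nrm \<A> (cl (\<lambda>i. p n) \<ominus>\<^bsub>\<A>\<^esub> cl p)) \<longlonglongrightarrow> 0" by simp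
  have "(\<lambda>n. nrm \<A> (x n \<ominus>\<^bsub>\<A>\<^esub> cl p)) \<longlonglongrightarrow> 0"
  proof (rule tendsto_sandwich[OF _ _ tendsto_const lim]; rule always_eventually; rule allI)
    fix n
    show "0 \<le> nrm \<A> (x n \<ominus>\<^bsub>\<A>\<^esub> cl p)" unfolding X(2)
      by (rule Lim_bounded2[OF nrm_lim[OF X(1) pC], of 0]) (auto intro: univ_nonneg star_polys_diff p cauchyD X)
    show "nrm \<A> (x n \<ominus>\<^bsub>\<A>\<^esub> cl p) \<le> inverse (real (Suc n)) + nrm \<A> (cl (\<lambda>i. p n) \<ominus>\<^bsub>\<A>\<^esub> cl p)"
      using tri[OF X(1)[of n] cauchy_const[OF p(1)[of n]] pC] p(2)[of n] by (simp add: X(2))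
  qed
  then show ?thesis using carrierI[OF pC] by blast
qed

theorem univ_cstar_algebra: "cstar_algebra \<A>"
proof -
  note simps = univ_add_cl univ_mult_cl univ_smult_cl univ_adj_cl cauchy_add cauchy_mult cauchy_scale
    cauchy_adj carrierI
  show ?thesis
  proof (intro cstar_algebra.intro cstar_algebra_axioms.intro univ_ring univ_module)
    fix x assume "x \<in> carrier \<A>"
    then obtain X where X: "X \<in> \<C>" "x = cl X" by (rule carrierE)
    note lim = univ_nrm_cl[OF X(1), folded X(2)]
    have "x = \<zero>\<^bsub>\<A>\<^esub> \<longleftrightarrow> (\<lambda>n. \<N> (X n)) \<longlonglongrightarrow> 0"
      using X by (simp add: univ_zero_cl cl_eq_iff cauchy_const star_polys_zero eqv_def)
    then show "nrm \<A> x = 0 \<longleftrightarrow> x = \<zero>\<^bsub>\<A>\<^esub>"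
      using lim LIMSEQ_unique[OF lim] by metis
    show "nrm \<A> (c \<odot>\<^bsub>\<A>\<^esub> x) = cmod c * nrm \<A> x" for c
    proof (rule LIMSEQ_unique)
      show "(\<lambda>n. \<N> (poly_scale c (X n))) \<longlonglongrightarrow> nrm \<A> (c \<odot>\<^bsub>\<A>\<^esub> x)"
        using univ_nrm_cl[OF cauchy_scale[OF X(1), of c]] X by (simp add: univ_smult_cl)
      show "(\<lambda>n. \<N> (poly_scale c (X n))) \<longlonglongrightarrow> cmod c * nrm \<A> x"
        using tendsto_mult_left[OF lim, of "cmod c"] X by (simp add: univ_scale cauchyD)
    qed
    show "nrm \<A> (adj \<A> x \<otimes>\<^bsub>\<A>\<^esub> x) = (nrm \<A> x)\<^sup>2"
    proof (rule LIMSEQ_unique)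
      show "(\<lambda>n. \<N> (poly_adj (X n) * X n)) \<longlonglongrightarrow> nrm \<A> (adj \<A> x \<otimes>\<^bsub>\<A>\<^esub> x)"
        using univ_nrm_cl[OF cauchy_mult[OF cauchy_adj[OF X(1)] X(1)]] X by (simp add: simps)
      show "(\<lambda>n. \<N> (poly_adj (X n) * X n)) \<longlonglongrightarrow> (nrm \<A> x)\<^sup>2"
        using tendsto_power[OF lim, of 2] X by (simp add: univ_cstar cauchyD)
    qed
    fix y assume "y \<in> carrier \<A>"
    then obtain Y where Y: "Y \<in> \<C>" "y = cl Y" by (rule carrierE)
    note lim' = univ_nrm_cl[OF Y(1), folded Y(2)]
    show "nrm \<A> (x \<oplus>\<^bsub>\<A>\<^esub> y) \<le> nrm \<A> x + nrm \<A> y"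
      unfolding X(2) Y(2) univ_add_cl[OF X(1) Y(1)]
      by (rule LIMSEQ_le[OF univ_nrm_cl[OF cauchy_add[OF X(1) Y(1)]]
            tendsto_add[OF lim[unfolded X(2)] lim'[unfolded Y(2)]]])
        (use X Y in \<open>auto intro!: univ_add cauchyD\<close>)
    show "nrm \<A> (x \<otimes>\<^bsub>\<A>\<^esub> y) \<le> nrm \<A> x * nrm \<A> y"
      unfolding X(2) Y(2) univ_mult_cl[OF X(1) Y(1)]
      by (rule LIMSEQ_le[OF univ_nrm_cl[OF cauchy_mult[OF X(1) Y(1)]]
            tendsto_mult[OF lim[unfolded X(2)] lim'[unfolded Y(2)]]])
        (use X Y in \<open>auto intro!: univ_mult cauchyD\<close>)
  next
    fix x :: "nat \<Rightarrow> (nat \<Rightarrow> 'g star_poly) set"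
    assume "\<And>n. x n \<in> carrier \<A>"
      "\<And>e. e > 0 \<Longrightarrow> \<exists>k. \<forall>m\<ge>k. \<forall>n\<ge>k. nrm \<A> (x m \<ominus>\<^bsub>\<A>\<^esub> x n) < e"
    then show "\<exists>l\<in>carrier \<A>. (\<lambda>n. nrm \<A> (x n \<ominus>\<^bsub>\<A>\<^esub> l)) \<longlonglongrightarrow> 0" by (rule univ_complete)
  qed (auto elim!: carrierE simp: simps poly_scale_mult_left poly_scale_mult_right poly_adj_add
      poly_adj_mult poly_adj_scale)
qed

end

subsection \<open>Evaluation of *-polynomials and the universal property\<close>

context cstar_algebra
begin

sublocale M: module complex_ring A
  rewrites "carrier complex_ring = UNIV" and "mult complex_ring = (*)" and "one complex_ring = 1"
    and "add complex_ring = (+)" and "zero complex_ring = 0"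
  by (simp_all add: complex_module) (simp_all add: complex_ring_def)

lemmas smult_simps = M.smult_closed[OF UNIV_I] M.smult_l_distr[OF UNIV_I UNIV_I]
  M.smult_r_distr[OF UNIV_I] M.smult_assoc1[OF UNIV_I UNIV_I] M.smult_one

lemma smult_commute: "x \<in> carrier A \<Longrightarrow> c \<odot> (d \<odot> x) = d \<odot> (c \<odot> x)"
  by (simp add: smult_simps(4)[symmetric] mult.commute)

lemma smult_zero_left: "x \<in> carrier A \<Longrightarrow> 0 \<odot> x = \<zero>"
  using smult_simps(2)[of x 0 0] smult_simps(1)[of x 0] by (simp add: local.add.l_cancel_one)

lemma smult_zero_right: "c \<odot> \<zero> = \<zero>"
  using smult_simps(3)[of \<zero> \<zero> c] smult_simps(1)[of \<zero> c] by (simp add: local.add.l_cancel_one)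

lemma adj_one: "adj A \<one> = \<one>"
  by (metis adj_adj adj_closed adj_mult l_one one_closed r_one)

lemma adj_zero: "adj A \<zero> = \<zero>"
  using adj_add[of \<zero> \<zero>] adj_closed[of \<zero>] by (simp add: local.add.l_cancel_one)

lemma smult_minus_one: "x \<in> carrier A \<Longrightarrow> (- 1) \<odot> x = \<ominus> x"
  using smult_simps(2)[of x "-1" 1]
  by (intro minus_equality[symmetric]) (simp_all add: smult_simps(1,5) smult_zero_left)

lemma nrm_uminus: "x \<in> carrier A \<Longrightarrow> nrm A (\<ominus> x) = nrm A x"
  by (simp add: smult_minus_one[symmetric] nrm_smult)

lemma nrm_nonneg: "x \<in> carrier A \<Longrightarrow> 0 \<le> nrm A x"
  using nrm_add[of x "\<ominus> x"] nrm_eq_0[of \<zero>] by (simp add: nrm_uminus r_neg)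

lemma nrm_adj: assumes x: "x \<in> carrier A" shows "nrm A (adj A x) = nrm A x"
proof -
  have *: "nrm A y \<le> nrm A (adj A y)" if y: "y \<in> carrier A" for y
  proof (cases "nrm A y = 0")
    case True
    then show ?thesis using nrm_nonneg[OF adj_closed[OF y]] by simp
  next
    case False
    then have "0 < nrm A y" using nrm_nonneg[OF y] by simp
    moreover have "nrm A y * nrm A y \<le> nrm A (adj A y) * nrm A y"
      using nrm_mult[OF adj_closed[OF y] y] nrm_cstar[OF y] by (simp add: power2_eq_square)
    ultimately show ?thesis by simp
  qed
  show ?thesis using *[OF x] *[OF adj_closed[OF x]] x by (simp add: adj_adj)
qed

definition eval_letter :: "('g \<Rightarrow> 'a) \<Rightarrow> 'g \<times> bool \<Rightarrow> 'a"
  where "eval_letter f l = (if snd l then adj A (f (fst l)) else f (fst l))"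

definition eval_word :: "('g \<Rightarrow> 'a) \<Rightarrow> 'g word \<Rightarrow> 'a"
  where "eval_word f w = foldr (\<otimes>) (map (eval_letter f) (letters w)) \<one>"

definition eval_poly :: "('g \<Rightarrow> 'a) \<Rightarrow> 'g star_poly \<Rightarrow> 'a"
  where "eval_poly f p =
    (\<Oplus>w\<in>Poly_Mapping.keys p. Poly_Mapping.lookup p w \<odot> eval_word f w)"

context
  fixes f :: "'g \<Rightarrow> 'a" and G :: "'g set"
  assumes f: "f ` G \<subseteq> carrier A"
begin

lemma eval_letter_closed: "fst l \<in> G \<Longrightarrow> eval_letter f l \<in> carrier A"
  using f by (auto simp: eval_letter_def adj_closed image_subset_iff)

lemma foldr_eval:
  assumes "fst ` set ls \<subseteq> G" "x \<in> carrier A"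
  shows "foldr (\<otimes>) (map (eval_letter f) ls) x = foldr (\<otimes>) (map (eval_letter f) ls) \<one> \<otimes> x \<and>
    foldr (\<otimes>) (map (eval_letter f) ls) \<one> \<in> carrier A"
  using assms
proof (induction ls)
  case (Cons l ls)
  then have l: "eval_letter f l \<in> carrier A" by (intro eval_letter_closed) simp
  from Cons have "fst ` set ls \<subseteq> G" by simp
  note IH = Cons.IH[OF this Cons.prems(2)]
  show ?case using l IH Cons.prems(2) by (auto simp: m_assoc)
qed simp

lemma eval_word_closed: "fst ` set (letters w) \<subseteq> G \<Longrightarrow> eval_word f w \<in> carrier A"
  using foldr_eval[of "letters w" \<one>] by (simp add: eval_word_def)

lemma eval_word_zero: "eval_word f 0 = \<one>"
  by (simp add: eval_word_def zero_word_def)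

lemma eval_word_plus:
  assumes "fst ` set (letters v) \<subseteq> G" "fst ` set (letters w) \<subseteq> G"
  shows "eval_word f (v + w) = eval_word f v \<otimes> eval_word f w"
  using foldr_eval[OF assms(1) eval_word_closed[OF assms(2)]] by (simp add: eval_word_def plus_word_def)

lemma eval_letter_adj: "fst l \<in> G \<Longrightarrow> eval_letter f (apsnd Not l) = adj A (eval_letter f l)"
  using f by (cases l) (auto simp: eval_letter_def adj_adj image_subset_iff)

lemma eval_word_adj:
  "fst ` set (letters w) \<subseteq> G \<Longrightarrow> eval_word f (word_adj w) = adj A (eval_word f w)"
proof (induction "letters w" arbitrary: w)
  case Nil
  then show ?case by (simp add: eval_word_def word_adj_def adj_one)
next
  case (Cons l ls)
  have lw: "letters w = l # ls" using Cons.hyps(2) by simp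
  then have w: "w = Word [l] + Word ls" by (metis append_Cons append_Nil plus_word_def word.collapse word.sel)
  have l: "fst l \<in> G" "fst ` set ls \<subseteq> G" using Cons.prems unfolding lw by auto
  have IH: "eval_word f (word_adj (Word ls)) = adj A (eval_word f (Word ls))"
    using Cons.hyps(1)[of "Word ls"] l by simp
  have ls: "fst ` set (letters (word_adj (Word ls))) \<subseteq> G"
    using l by (force simp: word_adj_def)
  have l1: "eval_word f (Word [l]) = eval_letter f l"
    "eval_word f (word_adj (Word [l])) = eval_letter f (apsnd Not l)"
    using eval_letter_closed[of l] eval_letter_closed[of "apsnd Not l"] l
    by (simp_all add: eval_word_def word_adj_def)
  have "eval_word f (word_adj w) = eval_word f (word_adj (Word ls)) \<otimes> eval_word f (word_adj (Word [l]))"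
    unfolding w word_adj_plus
    by (rule eval_word_plus[OF ls]) (use l in \<open>simp add: word_adj_def\<close>)
  also have "\<dots> = adj A (eval_word f (Word [l]) \<otimes> eval_word f (Word ls))"
    using l by (simp add: IH l1 eval_letter_adj adj_mult eval_letter_closed eval_word_closed)
  also have "\<dots> = adj A (eval_word f w)"
    unfolding w using l by (subst eval_word_plus) auto
  finally show ?case .
qed

lemma eval_poly_superset:
  assumes "finite W" "Poly_Mapping.keys p \<subseteq> W" "\<And>w. w \<in> W \<Longrightarrow> fst ` set (letters w) \<subseteq> G"
  shows "eval_poly f p = (\<Oplus>w\<in>W. Poly_Mapping.lookup p w \<odot> eval_word f w)"
  unfolding eval_poly_def
  by (rule add.finprod_mono_neutral_cong_left)
    (use assms in \<open>auto simp: not_in_keys_iff_lookup_eq_zero smult_zero_left eval_word_closed smult_simps\<close>)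

lemma eval_poly_closed: "p \<in> star_polys G \<Longrightarrow> eval_poly f p \<in> carrier A"
  unfolding eval_poly_def
  by (intro finsum_closed) (auto simp: star_polys_def intro!: smult_simps(1) eval_word_closed)

lemma eval_poly_zero: "eval_poly f 0 = \<zero>"
  by (simp add: eval_poly_def)

lemma eval_poly_single:
  assumes "fst ` set (letters w) \<subseteq> G"
  shows "eval_poly f (Poly_Mapping.single w c) = c \<odot> eval_word f w"
  using assms by (subst eval_poly_superset[of "{w}"])
    (auto simp: eval_word_closed smult_simps finsum_insert)

lemma eval_poly_add:
  assumes "p \<in> star_polys G" "q \<in> star_polys G"
  shows "eval_poly f (p + q) = eval_poly f p \<oplus> eval_poly f q"
proof -
  let ?W = "Poly_Mapping.keys p \<union> Poly_Mapping.keys q"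
  have W: "fst ` set (letters w) \<subseteq> G" if "w \<in> ?W" for w
    using that assms unfolding star_polys_def by blast
  have 1: "eval_poly f p = (\<Oplus>w\<in>?W. Poly_Mapping.lookup p w \<odot> eval_word f w)"
    by (rule eval_poly_superset) (use W in auto)
  have 2: "eval_poly f q = (\<Oplus>w\<in>?W. Poly_Mapping.lookup q w \<odot> eval_word f w)"
    by (rule eval_poly_superset) (use W in auto)
  have "eval_poly f (p + q) = (\<Oplus>w\<in>?W. Poly_Mapping.lookup (p + q) w \<odot> eval_word f w)"
    by (rule eval_poly_superset) (use W keys_add[of p q] in auto)
  also have "\<dots> = (\<Oplus>w\<in>?W. Poly_Mapping.lookup p w \<odot> eval_word f w \<oplus>
      Poly_Mapping.lookup q w \<odot> eval_word f w)"
    using W by (intro finsum_cong') (auto simp: lookup_add smult_simps eval_word_closed)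
  also have "\<dots> = eval_poly f p \<oplus> eval_poly f q"
    unfolding 1 2 using W by (intro finsum_addf) (auto simp: smult_simps eval_word_closed)
  finally show ?thesis .
qed

lemma eval_poly_single_mult:
  assumes "fst ` set (letters w) \<subseteq> G" "q \<in> star_polys G"
  shows "eval_poly f (Poly_Mapping.single w c * q) = (c \<odot> eval_word f w) \<otimes> eval_poly f q"
  using assms(2)
proof (induction rule: star_polys_induct)
  case zero
  then show ?case using assms(1) by (simp add: eval_poly_zero eval_word_closed smult_simps)
next
  case (single_add v d q)
  note cl = eval_word_closed[OF assms(1)] eval_word_closed[OF single_add(1)] eval_poly_closed[OF single_add(2)]
  have vw: "fst ` set (letters (w + v)) \<subseteq> G"
    using assms(1) single_add(1) by (auto simp: plus_word_def)
  have "eval_poly f (Poly_Mapping.single w c * (Poly_Mapping.single v d + q)) =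
      eval_poly f (Poly_Mapping.single (w + v) (c * d)) \<oplus> eval_poly f (Poly_Mapping.single w c * q)"
    unfolding distrib_left mult_single
    by (intro eval_poly_add star_polys_single star_polys_mult vw assms single_add)
  also have "\<dots> = (c \<odot> eval_word f w) \<otimes> (d \<odot> eval_word f v) \<oplus> (c \<odot> eval_word f w) \<otimes> eval_poly f q"
    using cl by (simp add: single_add eval_poly_single[OF vw] eval_word_plus[OF assms(1)] smult_simps
        smult_mult_left smult_mult_right smult_commute)
  also have "\<dots> = (c \<odot> eval_word f w) \<otimes> eval_poly f (Poly_Mapping.single v d + q)"
    using cl by (simp add: eval_poly_add star_polys_single single_add eval_poly_single smult_simps r_distr)
  finally show ?case .
qed

lemma eval_poly_mult:
  assumes "p \<in> star_polys G" "q \<in> star_polys G"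
  shows "eval_poly f (p * q) = eval_poly f p \<otimes> eval_poly f q"
  using assms(1)
proof (induction rule: star_polys_induct)
  case zero
  then show ?case using assms(2) by (simp add: eval_poly_zero eval_poly_closed)
next
  case (single_add v d p)
  note cl = eval_word_closed[OF single_add(1)] eval_poly_closed[OF single_add(2)] eval_poly_closed[OF assms(2)]
  show ?case
    using cl single_add assms(2)
    by (simp add: distrib_right eval_poly_add star_polys_mult star_polys_single eval_poly_single_mult
        eval_poly_single l_distr smult_simps)
qed

lemma eval_poly_one: "eval_poly f 1 = \<one>"
  using eval_poly_single[of 0 1] by (simp add: eval_word_zero smult_simps zero_word_def[symmetric])
    (simp add: zero_word_def)

lemma eval_poly_scale: "p \<in> star_polys G \<Longrightarrow> eval_poly f (poly_scale c p) = c \<odot> eval_poly f p"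
  unfolding poly_scale_def
  by (subst eval_poly_single_mult)
    (auto simp: zero_word_def eval_word_zero[unfolded zero_word_def] smult_mult_left eval_poly_closed)

lemma eval_poly_diff:
  assumes "p \<in> star_polys G" "q \<in> star_polys G"
  shows "eval_poly f (p - q) = eval_poly f p \<ominus> eval_poly f q"
  using assms eval_poly_add[of p "poly_scale (-1) q"] eval_poly_scale[of q "-1"]
  by (simp add: star_polys_scale smult_minus_one eval_poly_closed a_minus_def)
    (simp add: poly_scale_minus_one)

lemma eval_poly_adj:
  assumes "p \<in> star_polys G"
  shows "eval_poly f (poly_adj p) = adj A (eval_poly f p)"
  using assms
proof (induction rule: star_polys_induct)
  case zero
  then show ?case by (simp add: eval_poly_zero adj_zero)
next
  case (single_add v d p)
  note cl = eval_word_closed[OF single_add(1)] eval_poly_closed[OF single_add(2)]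
  have v: "fst ` set (letters (word_adj v)) \<subseteq> G"
    using single_add(1) by (force simp: word_adj_def)
  show ?case
    using cl single_add v
    by (simp add: poly_adj_add poly_adj_single eval_poly_add star_polys_adj star_polys_single
        eval_poly_single eval_word_adj adj_add adj_smult smult_simps)
qed

lemma eval_poly_gen: "g \<in> G \<Longrightarrow> eval_poly f (poly_gen g) = f g"
  using f unfolding poly_gen_def
  by (subst eval_poly_single) (auto simp: eval_word_def eval_letter_def smult_simps image_subset_iff)

lemma eval_seminorm: "cstar_seminorm G (\<lambda>p. nrm A (eval_poly f p))"
  unfolding cstar_seminorm_def
  by (simp add: eval_poly_add eval_poly_scale eval_poly_mult eval_poly_adj star_polys_adj
      eval_poly_closed nrm_add nrm_mult nrm_smult nrm_cstar)

end

definition lim_in :: "(nat \<Rightarrow> 'a) \<Rightarrow> 'a \<Rightarrow> bool"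
  where "lim_in X l \<longleftrightarrow> (\<forall>n. X n \<in> carrier A) \<and> l \<in> carrier A \<and> (\<lambda>n. nrm A (X n \<ominus> l)) \<longlonglongrightarrow> 0"

lemma nrm_minus_commute: "x \<in> carrier A \<Longrightarrow> y \<in> carrier A \<Longrightarrow> nrm A (x \<ominus> y) = nrm A (y \<ominus> x)"
  using nrm_uminus[of "x \<ominus> y"] by (simp add: a_minus_def minus_add r_neg a_comm)

lemma nrm_minus_triangle:
  assumes "x \<in> carrier A" "y \<in> carrier A" "z \<in> carrier A"
  shows "nrm A (x \<ominus> z) \<le> nrm A (x \<ominus> y) + nrm A (y \<ominus> z)"
proof -
  have "x \<ominus> z = (x \<ominus> y) \<oplus> (y \<ominus> z)"
    using assms by (simp add: a_minus_def a_assoc) (simp add: a_assoc[symmetric] l_neg)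
  then show ?thesis using nrm_add[of "x \<ominus> y" "y \<ominus> z"] assms by simp
qed

lemma lim_in_le:
  assumes "h \<longlonglongrightarrow> 0" "\<And>n. X n \<in> carrier A" "l \<in> carrier A" "\<And>n. nrm A (X n \<ominus> l) \<le> h n"
  shows "lim_in X l"
  unfolding lim_in_def
  by (intro conjI allI assms tendsto_sandwich[OF _ _ tendsto_const assms(1)] always_eventually)
    (auto intro: nrm_nonneg assms)

lemma lim_in_unique: assumes "lim_in X l" "lim_in X m" shows "l = m"
proof -
  have c: "l \<in> carrier A" "m \<in> carrier A" "\<And>n. X n \<in> carrier A" using assms by (auto simp: lim_in_def)
  have "(\<lambda>n. nrm A (X n \<ominus> l) + nrm A (X n \<ominus> m)) \<longlonglongrightarrow> 0 + 0"
    using assms unfolding lim_in_def by (intro tendsto_add) auto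
  then have "nrm A (l \<ominus> m) \<le> 0 + 0"
    by (rule Lim_bounded2[of _ _ 0]) (use c nrm_minus_triangle[of l "X _" m] nrm_minus_commute[of l "X _"] in auto)
  then have "nrm A (l \<ominus> m) = 0" using nrm_nonneg[of "l \<ominus> m"] c by simp
  then have "l \<ominus> m = \<zero>" using c nrm_eq_0[of "l \<ominus> m"] by simp
  moreover have "l = (l \<ominus> m) \<oplus> m" using c by (simp add: a_minus_def a_assoc l_neg)
  ultimately show ?thesis using c by simp
qed

lemma lim_in_const: "x \<in> carrier A \<Longrightarrow> lim_in (\<lambda>n. x) x"
  using nrm_eq_0[of \<zero>] by (simp add: lim_in_def a_minus_def r_neg)

lemma lim_in_add: assumes "lim_in X l" "lim_in Y m" shows "lim_in (\<lambda>n. X n \<oplus> Y n) (l \<oplus> m)"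
proof -
  have c: "l \<in> carrier A" "m \<in> carrier A" "\<And>n. X n \<in> carrier A" "\<And>n. Y n \<in> carrier A"
    using assms by (auto simp: lim_in_def)
  have eq: "(X n \<oplus> Y n) \<ominus> (l \<oplus> m) = (X n \<ominus> l) \<oplus> (Y n \<ominus> m)" for n
    using c by (simp add: a_minus_def minus_add a_ac)
  show ?thesis
  proof (rule lim_in_le)
    show "(\<lambda>n. nrm A (X n \<ominus> l) + nrm A (Y n \<ominus> m)) \<longlonglongrightarrow> 0"
      using tendsto_add[OF assms[unfolded lim_in_def, THEN conjunct2, THEN conjunct2]] by simp
  qed (use c in \<open>auto simp: eq nrm_add\<close>)
qed

lemma lim_in_smult: assumes "lim_in X l" shows "lim_in (\<lambda>n. c \<odot> X n) (c \<odot> l)"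
proof -
  have cl: "l \<in> carrier A" "\<And>n. X n \<in> carrier A" using assms by (auto simp: lim_in_def)
  have eq: "c \<odot> X n \<ominus> c \<odot> l = c \<odot> (X n \<ominus> l)" for n
  proof -
    have "\<ominus> (c \<odot> l) = c \<odot> (\<ominus> l)"
      using cl smult_commute[of l "-1" c] by (simp add: smult_minus_one smult_simps(1))
    then show ?thesis using cl by (simp add: a_minus_def smult_simps(1,3))
  qed
  show ?thesis
  proof (rule lim_in_le)
    show "(\<lambda>n. cmod c * nrm A (X n \<ominus> l)) \<longlonglongrightarrow> 0"
      using tendsto_mult_left[OF assms[unfolded lim_in_def, THEN conjunct2, THEN conjunct2], of "cmod c"]
      by simp
  qed (use cl in \<open>auto simp: eq nrm_smult smult_simps\<close>)
qed

lemma lim_in_adj: assumes "lim_in X l" shows "lim_in (\<lambda>n. adj A (X n)) (adj A l)"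
proof -
  have cl: "l \<in> carrier A" "\<And>n. X n \<in> carrier A" using assms by (auto simp: lim_in_def)
  have eq: "adj A (X n) \<ominus> adj A l = adj A (X n \<ominus> l)" for n
  proof -
    have "adj A (\<ominus> l) = \<ominus> adj A l"
      using cl adj_smult[of l "-1"] by (simp add: smult_minus_one adj_closed)
    then show ?thesis using cl by (simp add: a_minus_def adj_add)
  qed
  show ?thesis
    using assms cl by (simp add: lim_in_def eq nrm_adj adj_closed)
qed

lemma lim_in_mult: assumes "lim_in X l" "lim_in Y m" shows "lim_in (\<lambda>n. X n \<otimes> Y n) (l \<otimes> m)"
proof -
  have c: "l \<in> carrier A" "m \<in> carrier A" "\<And>n. X n \<in> carrier A" "\<And>n. Y n \<in> carrier A"
    using assms by (auto simp: lim_in_def)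
  have lims: "(\<lambda>n. nrm A (X n \<ominus> l)) \<longlonglongrightarrow> 0" "(\<lambda>n. nrm A (Y n \<ominus> m)) \<longlonglongrightarrow> 0"
    using assms by (auto simp: lim_in_def)
  show ?thesis
  proof (rule lim_in_le)
    show "(\<lambda>n. (nrm A (X n \<ominus> l) + nrm A l) * nrm A (Y n \<ominus> m) + nrm A (X n \<ominus> l) * nrm A m) \<longlonglongrightarrow> 0"
      using lims by (auto intro!: tendsto_eq_intros)
    fix n
    have eq: "X n \<otimes> Y n \<ominus> l \<otimes> m = X n \<otimes> (Y n \<ominus> m) \<oplus> (X n \<ominus> l) \<otimes> m"
    proof -
      have "X n \<otimes> (Y n \<ominus> m) \<oplus> (X n \<ominus> l) \<otimes> m =
          (X n \<otimes> Y n \<ominus> X n \<otimes> m) \<oplus> (X n \<otimes> m \<ominus> l \<otimes> m)"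
        using c by (simp add: a_minus_def r_distr l_distr r_minus l_minus)
      also have "\<dots> = X n \<otimes> Y n \<ominus> l \<otimes> m"
        using c by (simp add: a_minus_def a_assoc) (simp add: a_assoc[symmetric] l_neg)
      finally show ?thesis by simp
    qed
    have "X n = (X n \<ominus> l) \<oplus> l" using c by (simp add: a_minus_def a_assoc l_neg)
    then have Xn: "nrm A (X n) \<le> nrm A (X n \<ominus> l) + nrm A l"
      using nrm_add[of "X n \<ominus> l" l] c by simp
    have "nrm A (X n \<otimes> Y n \<ominus> l \<otimes> m) \<le> nrm A (X n \<otimes> (Y n \<ominus> m)) + nrm A ((X n \<ominus> l) \<otimes> m)"
      unfolding eq using c by (intro nrm_add) auto
    also have "\<dots> \<le> nrm A (X n) * nrm A (Y n \<ominus> m) + nrm A (X n \<ominus> l) * nrm A m"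
      using c by (intro add_mono nrm_mult) auto
    also have "\<dots> \<le> (nrm A (X n \<ominus> l) + nrm A l) * nrm A (Y n \<ominus> m) + nrm A (X n \<ominus> l) * nrm A m"
      using Xn c by (intro add_mono mult_right_mono nrm_nonneg) auto
    finally show "nrm A (X n \<otimes> Y n \<ominus> l \<otimes> m) \<le>
      (nrm A (X n \<ominus> l) + nrm A l) * nrm A (Y n \<ominus> m) + nrm A (X n \<ominus> l) * nrm A m" .
  qed (use c in auto)
qed

end

context presentation
begin

lemma univ_gen_closed: "g \<in> G \<Longrightarrow> univ_gen G Q g \<in> carrier \<A>"
  by (simp add: univ_gen_def carrierI cauchy_const star_polys_gen)

lemma univ_eval:
  assumes p: "p \<in> \<P>"
  shows "cstar_algebra.eval_poly \<A> (univ_gen G Q) p = cl (\<lambda>n. p)"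
proof -
  interpret A: cstar_algebra \<A> by (rule univ_cstar_algebra)
  have c: "univ_gen G Q ` G \<subseteq> carrier \<A>" using univ_gen_closed by auto
  have letter: "A.eval_letter (univ_gen G Q) l = cl (\<lambda>n. Poly_Mapping.single (Word [l]) 1)"
    if "fst l \<in> G" for l
    using that by (cases l) (simp add: A.eval_letter_def univ_gen_def univ_adj_cl cauchy_const
        star_polys_gen, simp add: poly_gen_def poly_adj_single word_adj_def)
  have word: "A.eval_word (univ_gen G Q) (Word ls) = cl (\<lambda>n. Poly_Mapping.single (Word ls) 1)"
    if "fst ` set ls \<subseteq> G" for ls
    using that
  proof (induction ls)
    case Nil
    then show ?case
      by (simp add: A.eval_word_def univ_one_cl) (simp add: zero_word_def[symmetric])
  next
    case (Cons l ls)
    then have l: "fst l \<in> G" "fst ` set ls \<subseteq> G" by auto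
    then have "A.eval_word (univ_gen G Q) (Word (l # ls)) =
      cl (\<lambda>n. Poly_Mapping.single (Word [l]) 1) \<otimes>\<^bsub>\<A>\<^esub> cl (\<lambda>n. Poly_Mapping.single (Word ls) 1)"
      using Cons.IH letter[of l] by (simp add: A.eval_word_def)
    also have "\<dots> = cl (\<lambda>n. Poly_Mapping.single (Word (l # ls)) 1)"
      using l by (subst univ_mult_cl)
        (simp_all add: cauchy_const star_polys_single mult_single plus_word_def)
    finally show ?case .
  qed
  show ?thesis using p
  proof (induction rule: star_polys_induct)
    case zero
    then show ?case by (simp add: A.eval_poly_def univ_zero_cl)
  next
    case (single_add w d q)
    have "A.eval_word (univ_gen G Q) w = cl (\<lambda>n. Poly_Mapping.single w 1)"
      using word[of "letters w"] single_add(1) by simp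
    then show ?case
      using single_add
      by (simp add: A.eval_poly_add[OF c] star_polys_single A.eval_poly_single[OF c] univ_smult_cl
          univ_add_cl cauchy_const poly_scale_single)
  qed
qed

theorem univ_gen_rel:
  assumes "(p, q) \<in> Q" "p \<in> \<P>" "q \<in> \<P>"
  shows "cstar_algebra.eval_poly \<A> (univ_gen G Q) p = cstar_algebra.eval_poly \<A> (univ_gen G Q) q"
  using univ_rel[OF assms] assms by (simp add: univ_eval cl_eq_iff cauchy_const eqv_def)

theorem univ_property:
  fixes B :: "('b, 'm) star_alg_scheme" and f :: "'g \<Rightarrow> 'b"
  assumes B: "cstar_algebra B" and f: "f ` G \<subseteq> carrier B"
    and rel: "\<And>p q. (p, q) \<in> Q \<Longrightarrow> p \<in> \<P> \<and> q \<in> \<P> \<and>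
      cstar_algebra.eval_poly B f p = cstar_algebra.eval_poly B f q"
  shows "\<exists>\<phi>. star_hom \<A> B \<phi> \<and> (\<forall>g\<in>G. \<phi> (univ_gen G Q g) = f g)"
proof -
  interpret B: cstar_algebra B by (rule B)
  note ev = B.eval_poly_closed[OF f]
  have N: "(\<lambda>p. nrm B (B.eval_poly f p)) \<in> rel_seminorms G Q"
    using B.eval_seminorm[OF f] rel B.nrm_eq_0[of "\<zero>\<^bsub>B\<^esub>"]
    by (fastforce simp: rel_seminorms_def B.eval_poly_diff[OF f] ev a_minus_def B.r_neg)
  have le: "nrm B (B.eval_poly f p \<ominus>\<^bsub>B\<^esub> B.eval_poly f q) \<le> \<N> (p - q)" if "p \<in> \<P>" "q \<in> \<P>" for p q
    using le_univ_norm[OF N star_polys_diff[OF that]] that by (simp add: B.eval_poly_diff[OF f])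
  have ex: "\<exists>l. B.lim_in (\<lambda>n. B.eval_poly f (X n)) l" if X: "X \<in> \<C>" for X
  proof -
    have "\<exists>l\<in>carrier B. (\<lambda>n. nrm B (B.eval_poly f (X n) \<ominus>\<^bsub>B\<^esub> l)) \<longlonglongrightarrow> 0"
    proof (rule B.nrm_complete)
      show "B.eval_poly f (X n) \<in> carrier B" for n using X by (intro ev cauchyD)
      fix e :: real assume "e > 0"
      from cauchyE[OF X this]
      show "\<exists>k. \<forall>m\<ge>k. \<forall>n\<ge>k. nrm B (B.eval_poly f (X m) \<ominus>\<^bsub>B\<^esub> B.eval_poly f (X n)) < e"
        using le[OF cauchyD[OF X] cauchyD[OF X]] le_less_trans by blast
    qed
    then show ?thesis unfolding B.lim_in_def using X by (auto intro: ev cauchyD)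
  qed
  define \<phi> where "\<phi> x = (SOME l. B.lim_in (\<lambda>n. B.eval_poly f (class_rep x n)) l)" for x
  have \<phi>: "\<phi> (cl X) = l" if X: "X \<in> \<C>" and l: "B.lim_in (\<lambda>n. B.eval_poly f (X n)) l" for X l
  proof -
    let ?Y = "class_rep (cl X)"
    note Y = class_rep[OF X]
    have "B.lim_in (\<lambda>n. B.eval_poly f (?Y n)) l"
    proof (rule B.lim_in_le)
      have "(\<lambda>n. nrm B (B.eval_poly f (X n) \<ominus>\<^bsub>B\<^esub> l)) \<longlonglongrightarrow> 0" using l by (simp add: B.lim_in_def)
      from tendsto_add[OF Y(3)[unfolded eqv_def] this]
      show "(\<lambda>n. \<N> (?Y n - X n) + nrm B (B.eval_poly f (X n) \<ominus>\<^bsub>B\<^esub> l)) \<longlonglongrightarrow> 0" by simp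
      show lc: "l \<in> carrier B" using l by (simp add: B.lim_in_def)
      show yc: "B.eval_poly f (?Y n) \<in> carrier B" for n using Y by (intro ev cauchyD)
      fix n
      have xc: "B.eval_poly f (X n) \<in> carrier B" using X by (intro ev cauchyD)
      show "nrm B (B.eval_poly f (?Y n) \<ominus>\<^bsub>B\<^esub> l) \<le> \<N> (?Y n - X n) + nrm B (B.eval_poly f (X n) \<ominus>\<^bsub>B\<^esub> l)"
        using B.nrm_minus_triangle[OF yc[of n] xc lc] le[OF cauchyD[OF Y(1)] cauchyD[OF X], of n n] by linarith
    qed
    then show ?thesis unfolding \<phi>_def by (metis B.lim_in_unique someI)
  qed
  have lim: "B.lim_in (\<lambda>n. B.eval_poly f (X n)) (\<phi> (cl X))" if X: "X \<in> \<C>" for X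
    using ex[OF X] \<phi>[OF X] by metis
  have "star_hom \<A> B \<phi>"
    unfolding star_hom_def
  proof (intro conjI ballI allI)
    show "\<phi> \<in> carrier \<A> \<rightarrow> carrier B" using lim by (auto elim!: carrierE simp: B.lim_in_def)
    fix x assume "x \<in> carrier \<A>"
    then obtain X where X: "X \<in> \<C>" "x = cl X" by (rule carrierE)
    note Xp = cauchyD[OF X(1)]
    show "\<phi> (c \<odot>\<^bsub>\<A>\<^esub> x) = c \<odot>\<^bsub>B\<^esub> \<phi> x" for c
      unfolding X(2) univ_smult_cl[OF X(1)]
      using B.lim_in_smult[OF lim[OF X(1)], of c]
      by (intro \<phi> cauchy_scale X) (simp add: B.eval_poly_scale[OF f] Xp)
    show "\<phi> (adj \<A> x) = adj B (\<phi> x)"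
      unfolding X(2) univ_adj_cl[OF X(1)]
      using B.lim_in_adj[OF lim[OF X(1)]]
      by (intro \<phi> cauchy_adj X) (simp add: B.eval_poly_adj[OF f] Xp)
    fix y assume "y \<in> carrier \<A>"
    then obtain Y where Y: "Y \<in> \<C>" "y = cl Y" by (rule carrierE)
    note Yp = cauchyD[OF Y(1)]
    show "\<phi> (x \<oplus>\<^bsub>\<A>\<^esub> y) = \<phi> x \<oplus>\<^bsub>B\<^esub> \<phi> y"
      unfolding X(2) Y(2) univ_add_cl[OF X(1) Y(1)]
      using B.lim_in_add[OF lim[OF X(1)] lim[OF Y(1)]]
      by (intro \<phi> cauchy_add X Y) (simp add: B.eval_poly_add[OF f] Xp Yp)
    show "\<phi> (x \<otimes>\<^bsub>\<A>\<^esub> y) = \<phi> x \<otimes>\<^bsub>B\<^esub> \<phi> y"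
      unfolding X(2) Y(2) univ_mult_cl[OF X(1) Y(1)]
      using B.lim_in_mult[OF lim[OF X(1)] lim[OF Y(1)]]
      by (intro \<phi> cauchy_mult X Y) (simp add: B.eval_poly_mult[OF f] Xp Yp)
  qed
  moreover have "\<phi> (univ_gen G Q g) = f g" if "g \<in> G" for g
    unfolding univ_gen_def
  proof (rule \<phi>)
    show "(\<lambda>n. poly_gen g) \<in> \<C>" using that by (simp add: cauchy_const star_polys_gen)
    show "B.lim_in (\<lambda>n. B.eval_poly f (poly_gen g)) (f g)"
      using that f by (auto simp: B.eval_poly_gen[OF f] intro!: B.lim_in_const)
  qed
  ultimately show ?thesis by blast
qed

end


section \<open>The C*-algebra of a ring\<close>

datatype 'a tgen = GU 'a | GS 'a | GE "'a set"

definition nz_ideal :: "('a, 'm) ring_scheme \<Rightarrow> 'a set \<Rightarrow> bool"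
  where "nz_ideal R I \<longleftrightarrow> ideal I R \<and> I \<noteq> {\<zero>\<^bsub>R\<^esub>}"

definition T_gens :: "('a, 'm) ring_scheme \<Rightarrow> 'a tgen set"
  where "T_gens R = GU ` carrier R \<union> GS ` (carrier R - {\<zero>\<^bsub>R\<^esub>}) \<union> GE ` {I. nz_ideal R I}"

abbreviation (input) pu :: "'a \<Rightarrow> 'a tgen star_poly" where "pu x \<equiv> poly_gen (GU x)"
abbreviation (input) ps :: "'a \<Rightarrow> 'a tgen star_poly" where "ps a \<equiv> poly_gen (GS a)"
abbreviation (input) pe :: "'a set \<Rightarrow> 'a tgen star_poly" where "pe I \<equiv> poly_gen (GE I)"

inductive_set T_rels :: "('a, 'm) ring_scheme \<Rightarrow> ('a tgen star_poly \<times> 'a tgen star_poly) set"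
  for R (structure)
  where
    u_isometry: "x \<in> carrier R \<Longrightarrow> (poly_adj (pu x) * pu x, 1) \<in> T_rels R"
  | u_coisometry: "x \<in> carrier R \<Longrightarrow> (pu x * poly_adj (pu x), 1) \<in> T_rels R"
  | u_add: "\<lbrakk>x \<in> carrier R; y \<in> carrier R\<rbrakk> \<Longrightarrow> (pu x * pu y, pu (x \<oplus> y)) \<in> T_rels R"
  | s_isometry: "a \<in> carrier R - {\<zero>} \<Longrightarrow> (poly_adj (ps a) * ps a, 1) \<in> T_rels R"
  | s_mult: "\<lbrakk>a \<in> carrier R - {\<zero>}; b \<in> carrier R - {\<zero>}\<rbrakk>
      \<Longrightarrow> (ps a * ps b, ps (a \<otimes> b)) \<in> T_rels R"
  | s_u: "\<lbrakk>a \<in> carrier R - {\<zero>}; x \<in> carrier R\<rbrakk>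
      \<Longrightarrow> (ps a * pu x, pu (a \<otimes> x) * ps a) \<in> T_rels R"
  | e_adj: "nz_ideal R I \<Longrightarrow> (poly_adj (pe I), pe I) \<in> T_rels R"
  | e_idem: "nz_ideal R I \<Longrightarrow> (pe I * pe I, pe I) \<in> T_rels R"
  | e_inter: "\<lbrakk>nz_ideal R I; nz_ideal R J\<rbrakk> \<Longrightarrow> (pe (I \<inter> J), pe I * pe J) \<in> T_rels R"
  | e_top: "(pe (carrier R), 1) \<in> T_rels R"
  | s_e: "\<lbrakk>a \<in> carrier R - {\<zero>}; nz_ideal R I\<rbrakk>
      \<Longrightarrow> (ps a * pe I * poly_adj (ps a), pe ((\<lambda>x. a \<otimes> x) ` I)) \<in> T_rels R"
  | u_e_in: "\<lbrakk>nz_ideal R I; x \<in> I\<rbrakk> \<Longrightarrow> (pu x * pe I, pe I * pu x) \<in> T_rels R"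
  | u_e_notin: "\<lbrakk>nz_ideal R I; x \<in> carrier R; x \<notin> I\<rbrakk> \<Longrightarrow> (pe I * pu x * pe I, 0) \<in> T_rels R"

definition T_alg :: "('a, 'm) ring_scheme \<Rightarrow> (nat \<Rightarrow> 'a tgen star_poly) set star_alg"
  where "T_alg R = univ_cstar (T_gens R) (T_rels R)"

definition T_u :: "('a, 'm) ring_scheme \<Rightarrow> 'a \<Rightarrow> (nat \<Rightarrow> 'a tgen star_poly) set"
  where "T_u R x = univ_gen (T_gens R) (T_rels R) (GU x)"

definition T_s :: "('a, 'm) ring_scheme \<Rightarrow> 'a \<Rightarrow> (nat \<Rightarrow> 'a tgen star_poly) set"
  where "T_s R a = univ_gen (T_gens R) (T_rels R) (GS a)"

definition T_e :: "('a, 'm) ring_scheme \<Rightarrow> 'a set \<Rightarrow> (nat \<Rightarrow> 'a tgen star_poly) set"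
  where "T_e R I = univ_gen (T_gens R) (T_rels R) (GE I)"

subsection \<open>The relations in a C*-algebra, and the universal property\<close>

text \<open>
  \<open>T_family\<close> states the defining relations for elements of an arbitrary C*-algebra. Theorems
  \<open>T_alg_family\<close> and \<open>T_alg_universal\<close> below confirm that \<open>T_alg R\<close>
  is the universal C*-algebra for them.
\<close>

definition T_family ::
    "('a, 'm) ring_scheme \<Rightarrow> ('b, 'n) star_alg_scheme \<Rightarrow> ('a \<Rightarrow> 'b) \<Rightarrow> ('a \<Rightarrow> 'b) \<Rightarrow> ('a set \<Rightarrow> 'b) \<Rightarrow> bool"
  where "T_family R B u s e \<longleftrightarrow>
    (\<forall>x\<in>carrier R. u x \<in> carrier B \<and>
      adj B (u x) \<otimes>\<^bsub>B\<^esub> u x = \<one>\<^bsub>B\<^esub> \<and> u x \<otimes>\<^bsub>B\<^esub> adj B (u x) = \<one>\<^bsub>B\<^esub>) \<and>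
    (\<forall>x\<in>carrier R. \<forall>y\<in>carrier R. u x \<otimes>\<^bsub>B\<^esub> u y = u (x \<oplus>\<^bsub>R\<^esub> y)) \<and>
    (\<forall>a\<in>carrier R - {\<zero>\<^bsub>R\<^esub>}. s a \<in> carrier B \<and> adj B (s a) \<otimes>\<^bsub>B\<^esub> s a = \<one>\<^bsub>B\<^esub>) \<and>
    (\<forall>a\<in>carrier R - {\<zero>\<^bsub>R\<^esub>}. \<forall>b\<in>carrier R - {\<zero>\<^bsub>R\<^esub>}. s a \<otimes>\<^bsub>B\<^esub> s b = s (a \<otimes>\<^bsub>R\<^esub> b)) \<and>
    (\<forall>a\<in>carrier R - {\<zero>\<^bsub>R\<^esub>}. \<forall>x\<in>carrier R. s a \<otimes>\<^bsub>B\<^esub> u x = u (a \<otimes>\<^bsub>R\<^esub> x) \<otimes>\<^bsub>B\<^esub> s a) \<and>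
    (\<forall>I. nz_ideal R I \<longrightarrow> e I \<in> carrier B \<and> adj B (e I) = e I \<and> e I \<otimes>\<^bsub>B\<^esub> e I = e I) \<and>
    (\<forall>I J. nz_ideal R I \<longrightarrow> nz_ideal R J \<longrightarrow> e (I \<inter> J) = e I \<otimes>\<^bsub>B\<^esub> e J) \<and>
    e (carrier R) = \<one>\<^bsub>B\<^esub> \<and>
    (\<forall>a\<in>carrier R - {\<zero>\<^bsub>R\<^esub>}. \<forall>I. nz_ideal R I \<longrightarrow>
      s a \<otimes>\<^bsub>B\<^esub> e I \<otimes>\<^bsub>B\<^esub> adj B (s a) = e ((\<lambda>x. a \<otimes>\<^bsub>R\<^esub> x) ` I)) \<and>
    (\<forall>I. \<forall>x\<in>I. nz_ideal R I \<longrightarrow> u x \<otimes>\<^bsub>B\<^esub> e I = e I \<otimes>\<^bsub>B\<^esub> u x) \<and>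
    (\<forall>I. \<forall>x\<in>carrier R - I. nz_ideal R I \<longrightarrow> e I \<otimes>\<^bsub>B\<^esub> u x \<otimes>\<^bsub>B\<^esub> e I = \<zero>\<^bsub>B\<^esub>)"

lemma T_gens_iff [simp]:
  "GU x \<in> T_gens R \<longleftrightarrow> x \<in> carrier R"
  "GS a \<in> T_gens R \<longleftrightarrow> a \<in> carrier R \<and> a \<noteq> \<zero>\<^bsub>R\<^esub>"
  "GE I \<in> T_gens R \<longleftrightarrow> nz_ideal R I"
  by (auto simp: T_gens_def)

lemma (in domain) nz_ideal_carrier: "nz_ideal R (carrier R)"
  using oneideal one_not_zero one_closed unfolding nz_ideal_def by blast

lemma nz_ideal_subset: "nz_ideal R I \<Longrightarrow> x \<in> I \<Longrightarrow> x \<in> carrier R"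
  by (auto simp: nz_ideal_def ideal_def additive_subgroup.a_Hcarr)

lemma (in domain) nz_ideal_inter:
  assumes "nz_ideal R I" "nz_ideal R J" shows "nz_ideal R (I \<inter> J)"
proof -
  have I: "ideal I R" and J: "ideal J R" using assms by (auto simp: nz_ideal_def)
  have z: "\<zero> \<in> I" "\<zero> \<in> J"
    using I J by (auto simp: ideal_def additive_subgroup.zero_closed)
  obtain x y where xy: "x \<in> I" "x \<noteq> \<zero>" "y \<in> J" "y \<noteq> \<zero>"
    using z assms by (auto simp: nz_ideal_def)
  have c: "x \<in> carrier R" "y \<in> carrier R" using xy nz_ideal_subset[OF assms(1)] nz_ideal_subset[OF assms(2)] by auto
  have "x \<otimes> y \<in> I \<inter> J"
    using ideal.I_r_closed[OF I xy(1) c(2)] ideal.I_l_closed[OF J xy(3) c(1)] by simp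
  moreover have "x \<otimes> y \<noteq> \<zero>" using c xy by (simp add: integral_iff)
  ultimately show ?thesis using i_intersect[OF I J] by (auto simp: nz_ideal_def)
qed

lemma (in domain) nz_ideal_times:
  assumes a: "a \<in> carrier R" "a \<noteq> \<zero>" and I: "nz_ideal R I"
  shows "nz_ideal R ((\<lambda>x. a \<otimes> x) ` I)"
proof -
  have id: "ideal I R" using I by (simp add: nz_ideal_def)
  interpret I: ideal I R by (rule id)
  note sub = nz_ideal_subset[OF I]
  have "ideal ((\<lambda>x. a \<otimes> x) ` I) R"
  proof (rule idealI[OF ring_axioms])
    show "subgroup ((\<lambda>x. a \<otimes> x) ` I) (add_monoid R)"
    proof
      show "(\<lambda>x. a \<otimes> x) ` I \<subseteq> carrier (add_monoid R)" using a sub by auto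
      show "x \<otimes>\<^bsub>add_monoid R\<^esub> y \<in> (\<lambda>x. a \<otimes> x) ` I"
        if "x \<in> (\<lambda>x. a \<otimes> x) ` I" "y \<in> (\<lambda>x. a \<otimes> x) ` I" for x y
        using that a sub by (auto simp: r_distr[symmetric])
      show "\<one>\<^bsub>add_monoid R\<^esub> \<in> (\<lambda>x. a \<otimes> x) ` I"
        using a by (auto intro!: image_eqI[of _ _ \<zero>])
      show "inv\<^bsub>add_monoid R\<^esub> x \<in> (\<lambda>x. a \<otimes> x) ` I" if x: "x \<in> (\<lambda>x. a \<otimes> x) ` I" for x
      proof -
        obtain y where y: "y \<in> I" "x = a \<otimes> y" using x by auto
        have "\<ominus> x = a \<otimes> (\<ominus> y)" using y a sub by (simp add: r_minus)
        then show ?thesis using y by (auto simp: a_inv_def[symmetric])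
      qed
    qed
    fix x r assume x: "x \<in> (\<lambda>x. a \<otimes> x) ` I" and r: "r \<in> carrier R"
    obtain y where y: "y \<in> I" "x = a \<otimes> y" using x by auto
    have eq: "r \<otimes> x = a \<otimes> (r \<otimes> y)" "x \<otimes> r = a \<otimes> (y \<otimes> r)"
      using a r y sub by (simp_all add: m_lcomm m_assoc)
    show "r \<otimes> x \<in> (\<lambda>x. a \<otimes> x) ` I" "x \<otimes> r \<in> (\<lambda>x. a \<otimes> x) ` I"
      unfolding eq using y r I.I_l_closed I.I_r_closed by auto
  qed
  moreover obtain x where x: "x \<in> I" "x \<noteq> \<zero>"
    using I I.zero_closed by (auto simp: nz_ideal_def)
  moreover have "a \<otimes> x \<noteq> \<zero>" using a x sub by (simp add: integral_iff)
  ultimately show ?thesis by (auto simp: nz_ideal_def)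
qed

lemmas T_poly_simps = star_polys_gen star_polys_one star_polys_zero star_polys_mult star_polys_adj

context domain
begin

lemma T_rels_polys:
  assumes "(p, q) \<in> T_rels R"
  shows "p \<in> star_polys (T_gens R) \<and> q \<in> star_polys (T_gens R)"
  using assms
  by cases (auto simp: T_poly_simps nz_ideal_inter nz_ideal_times nz_ideal_carrier
      nz_ideal_subset integral_iff)

lemma T_presentation: "presentation (T_gens R) (T_rels R)"
proof
  fix g assume g: "g \<in> T_gens R"
  have "N (poly_gen g) \<le> 1" if N: "N \<in> rel_seminorms (T_gens R) (T_rels R)" for N
  proof -
    have s: "cstar_seminorm (T_gens R) N" and r: "\<And>p q. (p, q) \<in> T_rels R \<Longrightarrow> N (p - q) = 0"
      using N by (auto simp: rel_seminorms_def)
    show ?thesis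
    proof (cases g)
      case (GU x)
      then show ?thesis using g r[OF T_rels.u_isometry[of x R]]
        by (intro seminorm_isometry_le[OF s]) (auto simp: star_polys_gen)
    next
      case (GS a)
      then show ?thesis using g r[OF T_rels.s_isometry[of a R]]
        by (intro seminorm_isometry_le[OF s]) (auto simp: star_polys_gen)
    next
      case (GE I)
      then show ?thesis using g r[OF T_rels.e_adj[of R I]] r[OF T_rels.e_idem[of R I]]
        by (intro seminorm_projection_le[OF s]) (auto simp: star_polys_gen)
    qed
  qed
  then show "\<exists>b. \<forall>N\<in>rel_seminorms (T_gens R) (T_rels R). N (poly_gen g) \<le> b" by blast
qed

theorem T_alg_cstar: "cstar_algebra (T_alg R)"
  unfolding T_alg_def by (rule presentation.univ_cstar_algebra[OF T_presentation])

theorem T_alg_family: "T_family R (T_alg R) (T_u R) (T_s R) (T_e R)"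
proof -
  interpret P: presentation "T_gens R" "T_rels R" by (rule T_presentation)
  interpret B: cstar_algebra "T_alg R" by (rule T_alg_cstar)
  let ?f = "univ_gen (T_gens R) (T_rels R)"
  have f: "?f ` T_gens R \<subseteq> carrier (T_alg R)"
    using P.univ_gen_closed by (auto simp: T_alg_def)
  have rel: "B.eval_poly ?f p = B.eval_poly ?f q" if "(p, q) \<in> T_rels R" for p q
    using P.univ_gen_rel[OF that] T_rels_polys[OF that] by (simp add: T_alg_def)
  note ev = B.eval_poly_gen[OF f] B.eval_poly_mult[OF f] B.eval_poly_adj[OF f] B.eval_poly_one[OF f]
    B.eval_poly_zero[OF f] T_poly_simps nz_ideal_inter nz_ideal_times nz_ideal_carrier
    nz_ideal_subset integral_iff
  show ?thesis
    unfolding T_family_def T_u_def T_s_def T_e_def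
  proof (intro conjI ballI allI impI)
    show "?f (GU x) \<in> carrier (T_alg R)" if "x \<in> carrier R" for x
      using f that by auto
    show "?f (GS a) \<in> carrier (T_alg R)" if "a \<in> carrier R - {\<zero>}" for a
      using f that by auto
    show "?f (GE I) \<in> carrier (T_alg R)" if "nz_ideal R I" for I
      using f that by auto
  qed (use rel[OF T_rels.u_isometry] rel[OF T_rels.u_coisometry] rel[OF T_rels.u_add]
      rel[OF T_rels.s_isometry] rel[OF T_rels.s_mult] rel[OF T_rels.s_u] rel[OF T_rels.e_adj]
      rel[OF T_rels.e_idem] rel[OF T_rels.e_inter] rel[OF T_rels.e_top] rel[OF T_rels.s_e]
      rel[OF T_rels.u_e_in] rel[OF T_rels.u_e_notin] in \<open>simp_all add: ev\<close>)
qed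

theorem T_alg_universal:
  assumes B: "cstar_algebra B" and fam: "T_family R B u s e"
  shows "\<exists>\<phi>. star_hom (T_alg R) B \<phi> \<and>
    (\<forall>x\<in>carrier R. \<phi> (T_u R x) = u x) \<and>
    (\<forall>a\<in>carrier R - {\<zero>}. \<phi> (T_s R a) = s a) \<and>
    (\<forall>I. nz_ideal R I \<longrightarrow> \<phi> (T_e R I) = e I)"
proof -
  interpret P: presentation "T_gens R" "T_rels R" by (rule T_presentation)
  interpret B: cstar_algebra B by (rule B)
  let ?f = "case_tgen u s e"
  have f: "?f ` T_gens R \<subseteq> carrier B"
    using fam by (auto simp: T_gens_def T_family_def)
  note ev = B.eval_poly_gen[OF f] B.eval_poly_mult[OF f] B.eval_poly_adj[OF f] B.eval_poly_one[OF f]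
    B.eval_poly_zero[OF f] T_poly_simps nz_ideal_inter nz_ideal_times nz_ideal_carrier
    nz_ideal_subset integral_iff
  have rel: "B.eval_poly ?f p = B.eval_poly ?f q" if "(p, q) \<in> T_rels R" for p q
    using that
    by cases (use fam in \<open>simp_all add: ev T_family_def\<close>)
  obtain \<phi> where \<phi>: "star_hom (T_alg R) B \<phi>"
    "\<And>g. g \<in> T_gens R \<Longrightarrow> \<phi> (univ_gen (T_gens R) (T_rels R) g) = ?f g"
    using P.univ_property[OF B f] rel T_rels_polys unfolding T_alg_def by blast
  then show ?thesis by (intro exI[of _ \<phi>]) (simp add: T_u_def T_s_def T_e_def)
qed

end


section \<open>Rings of algebraic integers in number fields\<close>

definition number_field :: "'a::field_char_0 set \<Rightarrow> bool"
  where "number_field K \<longleftrightarrow>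
    0 \<in> K \<and> 1 \<in> K \<and>
    (\<forall>x\<in>K. \<forall>y\<in>K. x + y \<in> K \<and> x * y \<in> K) \<and>
    (\<forall>x\<in>K. - x \<in> K \<and> inverse x \<in> K) \<and>
    (\<exists>B. finite B \<and> B \<subseteq> K \<and> (\<forall>x\<in>K. \<exists>c :: 'a \<Rightarrow> rat. x = (\<Sum>b\<in>B. of_rat (c b) * b)))"

definition ring_of_integers :: "'a::field_char_0 set \<Rightarrow> 'a ring"
  where "ring_of_integers K =
    \<lparr>carrier = {x \<in> K. algebraic_int x}, mult = (*), one = 1, zero = 0, add = (+)\<rparr>"

end

theory Submission
  imports "Jordan_Normal_Form.Char_Poly" Defs
begin

text \<open>
  By the universal property it suffices that \<open>I \<mapsto> \<alpha>(I)S\<close> respects the ideal operations in the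
  defining relations. The only nontrivial points are \<open>\<alpha>(I \<inter> J)S = \<alpha>(I)S \<inter> \<alpha>(J)S\<close> and
  \<open>\<alpha>\<^sup>-\<^sup>1(\<alpha>(I)S) = I\<close>. Both follow from the invertibility of finitely generated ideals of \<open>R\<close>, in
  the form of a partition of unity: for a finite set \<open>A\<close> of generators there are \<open>u a\<close> with
  sum \<open>1\<close> and \<open>u a \<cdot> b / a \<in> R\<close> for all \<open>a, b \<in> A\<close>. Multiplying \<open>y \<in> \<alpha>(A)S\<close> by \<open>\<alpha>(u a)\<close> gives
  a multiple of the single element \<open>\<alpha>(a)\<close>, which reduces both claims to principal ideals.
\<close>

subsection \<open>Algebraic integers\<close>

text \<open>Determinant trick: the vector listing \<open>B\<close> is an eigenvector of the matrix
  of the \<open>h (c b b')\<close> for the eigenvalue \<open>x\<close>, so \<open>x\<close> is a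
  root of the characteristic polynomial, which is monic with coefficients in the source of
  \<open>h\<close>. The map \<open>h\<close> is left open so that \<open>of_int\<close> yields
  integrality and \<open>of_rat\<close> yields algebraicity.\<close>

lemma monic_root_of_stable_span:
  fixes x :: "'a::field" and h :: "'c::comm_ring_1 \<Rightarrow> 'a"
  assumes h: "comm_ring_hom h"
    and fin: "finite B" and b0: "b0 \<in> B" "b0 \<noteq> 0"
    and stable: "\<And>b. b \<in> B \<Longrightarrow> x * b = (\<Sum>b'\<in>B. h (c b b') * b')"
  shows "\<exists>p. lead_coeff p = 1 \<and> poly (map_poly h p) x = 0"
proof -
  interpret comm_ring_hom h by (rule h)
  obtain bs where bs: "set bs = B" "distinct bs" using finite_distinct_list[OF fin] by blast
  define n where "n = length bs"
  define M where "M = mat n n (\<lambda>(i, j). c (bs ! i) (bs ! j))"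
  define v where "v = vec n (\<lambda>i. bs ! i)"
  have M: "M \<in> carrier_mat n n" by (simp add: M_def)
  have sum_bs: "(\<Sum>j<n. f (bs ! j)) = (\<Sum>b\<in>B. f b)" for f :: "'a \<Rightarrow> 'a"
    using bs by (intro sum.reindex_bij_betw bij_betw_nth) (auto simp: n_def)
  have "map_mat h M *\<^sub>v v = x \<cdot>\<^sub>v v"
  proof (rule eq_vecI)
    fix i assume "i < dim_vec (x \<cdot>\<^sub>v v)"
    then have i: "i < n" by (simp add: v_def)
    then have "(map_mat h M *\<^sub>v v) $ i = (\<Sum>j<n. h (c (bs ! i) (bs ! j)) * bs ! j)"
      by (simp add: M_def v_def scalar_prod_def atLeast0LessThan)
    also have "\<dots> = x * bs ! i"
      unfolding sum_bs[of "\<lambda>b. h (c (bs ! i) b) * b"] using i bs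
      by (intro stable[symmetric]) (auto simp: n_def)
    finally show "(map_mat h M *\<^sub>v v) $ i = (x \<cdot>\<^sub>v v) $ i" using i by (simp add: v_def)
  qed (simp add: M_def v_def)
  moreover have "v \<noteq> 0\<^sub>v n"
  proof
    assume "v = 0\<^sub>v n"
    then have "\<forall>i<n. bs ! i = 0" by (metis index_vec index_zero_vec(1) v_def)
    then show False using b0 bs by (metis in_set_conv_nth n_def)
  qed
  ultimately have "eigenvalue (map_mat h M) x"
    unfolding eigenvalue_def eigenvector_def by (intro exI[of _ v]) (simp add: M_def v_def)
  then have "poly (map_poly h (char_poly M)) x = 0"
    using eigenvalue_root_char_poly[of "map_mat h M" n x] M by (simp add: char_poly_hom)
  then show ?thesis using degree_monic_char_poly[OF M] by auto
qed

interpretation int_module: Modules.module "\<lambda>(k::int) (x::'a::comm_ring_1). of_int k * x"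
  by standard (simp_all add: algebra_simps)

text \<open>The integrality criterion behind all the closure properties below. The element 1 of
  \<open>B\<close> supplies the nonzero entry that an eigenvector needs.\<close>

lemma algebraic_int_stable_span:
  fixes x :: "'a::field_char_0"
  assumes "finite B" "1 \<in> B" and stable: "\<And>b. b \<in> B \<Longrightarrow> x * b \<in> int_module.span B"
  shows "algebraic_int x"
proof -
  have "\<forall>b\<in>B. \<exists>c. x * b = (\<Sum>b'\<in>B. of_int (c b') * b')"
    using stable unfolding int_module.span_finite[OF assms(1)] by auto
  then obtain c where "\<And>b. b \<in> B \<Longrightarrow> x * b = (\<Sum>b'\<in>B. of_int (c b b') * b')"
    by metis
  then show ?thesis
    using monic_root_of_stable_span[of of_int B 1 x c] assms of_int_hom.comm_ring_hom_axioms
    by (auto simp: algebraic_int_altdef_ipoly)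
qed

section \<open>Closure of the algebraic integers under sums and products\<close>

lemma int_span_mult_closed:
  assumes "\<And>b. b \<in> B \<Longrightarrow> x * b \<in> int_module.span B" and "m \<in> int_module.span B"
  shows "x * m \<in> int_module.span B"
  using assms(2)
proof (induction rule: int_module.span_induct_alt)
  case base
  then show ?case by (simp add: int_module.span_zero)
next
  case (step k b m)
  have "x * (of_int k * b + m) = of_int k * (x * b) + x * m" by (simp add: algebra_simps)
  then show ?case
    using step assms(1) int_module.span_add int_module.span_scale by metis
qed

lemma algebraic_int_power_span:
  fixes x :: "'a::field_char_0"
  assumes "algebraic_int x"
  obtains n where "n > 0" "x ^ n \<in> int_module.span ((\<lambda>i. x ^ i) ` {..<n})"
proof -
  obtain p where p: "poly (map_poly of_int p) x = 0" "lead_coeff p = 1"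
    using assms by (auto simp: algebraic_int_altdef_ipoly)
  define n where "n = degree p"
  have "0 = (\<Sum>i\<le>n. of_int (coeff p i) * x ^ i)"
    using p(1) by (simp add: poly_altdef n_def coeff_map_poly)
  also have "\<dots> = x ^ n + (\<Sum>i<n. of_int (coeff p i) * x ^ i)"
    using p(2) by (simp add: n_def lessThan_Suc_atMost[symmetric])
  finally have "x ^ n = - (\<Sum>i<n. of_int (coeff p i) * x ^ i)"
    by (simp add: eq_neg_iff_add_eq_0)
  moreover have "- (\<Sum>i<n. of_int (coeff p i) * x ^ i) \<in> int_module.span ((\<lambda>i. x ^ i) ` {..<n})"
    by (intro int_module.span_neg int_module.span_sum int_module.span_scale int_module.span_base)
      auto
  ultimately have "x ^ n \<in> int_module.span ((\<lambda>i. x ^ i) ` {..<n})" by simp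
  \<comment> \<open>In degree 0 a monic polynomial is 1, which has no root.\<close>
  moreover have "n > 0"
  proof (rule ccontr)
    assume "\<not> n > 0"
    then have "p = [:1:]" using p(2) by (cases p) (auto simp: n_def split: if_splits)
    then show False using p(1) by simp
  qed
  ultimately show ?thesis using that by blast
qed

text \<open>A module stable under both \<open>x\<close> and \<open>y\<close> is stable under their
  sum and product, so the criterion applies to those as well. The monomials
  \<open>x ^ i * y ^ j\<close> with \<open>i < k\<close> and \<open>j < l\<close> span such a
  module: multiplication leaves the range of exponents only at \<open>x ^ k\<close> or
  \<open>y ^ l\<close>, and these reduce to lower powers.\<close>

lemma algebraic_int_common_span:
  fixes x y :: "'a::field_char_0"
  assumes "algebraic_int x" "algebraic_int y"
  obtains B where "finite B" "1 \<in> B"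
    "\<And>m. m \<in> int_module.span B \<Longrightarrow> x * m \<in> int_module.span B"
    "\<And>m. m \<in> int_module.span B \<Longrightarrow> y * m \<in> int_module.span B"
proof -
  obtain k where k: "k > 0" "x ^ k \<in> int_module.span ((\<lambda>i. x ^ i) ` {..<k})"
    using algebraic_int_power_span assms by blast
  obtain l where l: "l > 0" "y ^ l \<in> int_module.span ((\<lambda>i. y ^ i) ` {..<l})"
    using algebraic_int_power_span assms by blast
  define B where "B = (\<lambda>(i, j). x ^ i * y ^ j) ` ({..<k} \<times> {..<l})"
  have B: "x ^ i * y ^ j \<in> int_module.span B" if "i < k" "j < l" for i j
    using that by (auto simp: B_def intro!: int_module.span_base)
  \<comment> \<open>This lets a reduction of \<open>x ^ k\<close> or \<open>y ^ l\<close> to lower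
    powers be carried out inside a product with a power of the other element.\<close>
  have mult: "z * w \<in> int_module.span B"
    if "z \<in> int_module.span C" "\<And>c. c \<in> C \<Longrightarrow> c * w \<in> int_module.span B" for z w :: 'a and C
    using that(1)
  proof (induction rule: int_module.span_induct_alt)
    case base
    then show ?case by (simp add: int_module.span_zero)
  next
    case (step e c m)
    then show ?case using int_module.span_add[OF int_module.span_scale[OF that(2), of c e] step(2)]
      by (simp add: algebra_simps)
  qed
  have x: "x * b \<in> int_module.span B" if "b \<in> B" for b
  proof -
    obtain i j where ij: "b = x ^ i * y ^ j" "i < k" "j < l" using \<open>b \<in> B\<close> by (auto simp: B_def)
    show ?thesis
    proof (cases "Suc i < k")
      case True
      then show ?thesis using B[of "Suc i" j] ij by (simp add: mult.assoc)
    next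
      case False
      then have "Suc i = k" using ij by simp
      then have "x * b = x ^ k * y ^ j" using ij by (auto simp: mult.assoc)
      moreover have "x ^ k * y ^ j \<in> int_module.span B"
        by (rule mult[OF k(2)]) (use ij B in auto)
      ultimately show ?thesis by simp
    qed
  qed
  have y: "y * b \<in> int_module.span B" if "b \<in> B" for b
  proof -
    obtain i j where ij: "b = x ^ i * y ^ j" "i < k" "j < l" using \<open>b \<in> B\<close> by (auto simp: B_def)
    show ?thesis
    proof (cases "Suc j < l")
      case True
      then show ?thesis using B[of i "Suc j"] ij by (simp add: mult_ac)
    next
      case False
      then have "Suc j = l" using ij by simp
      then have "y * b = y ^ l * x ^ i" using ij by (auto simp: mult_ac)
      moreover have "y ^ l * x ^ i \<in> int_module.span B"
        by (rule mult[OF l(2)]) (use ij B in \<open>auto simp: mult.commute\<close>)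
      ultimately show ?thesis by simp
    qed
  qed
  have "1 \<in> B" using k l by (auto simp: B_def intro!: image_eqI[of _ _ "(0, 0)"])
  moreover have "finite B" by (simp add: B_def)
  ultimately show ?thesis using that int_span_mult_closed x y by metis
qed

lemma algebraic_int_add:
  fixes x y :: "'a::field_char_0"
  assumes "algebraic_int x" "algebraic_int y"
  shows "algebraic_int (x + y)"
proof -
  obtain B where B: "finite B" "1 \<in> B"
    "\<And>m. m \<in> int_module.span B \<Longrightarrow> x * m \<in> int_module.span B"
    "\<And>m. m \<in> int_module.span B \<Longrightarrow> y * m \<in> int_module.span B"
    using algebraic_int_common_span[OF assms] by blast
  show ?thesis
    by (rule algebraic_int_stable_span[OF B(1,2)])
      (simp add: distrib_right int_module.span_add B int_module.span_base)
qed

lemma algebraic_int_mult: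
  fixes x y :: "'a::field_char_0"
  assumes "algebraic_int x" "algebraic_int y"
  shows "algebraic_int (x * y)"
proof -
  obtain B where B: "finite B" "1 \<in> B"
    "\<And>m. m \<in> int_module.span B \<Longrightarrow> x * m \<in> int_module.span B"
    "\<And>m. m \<in> int_module.span B \<Longrightarrow> y * m \<in> int_module.span B"
    using algebraic_int_common_span[OF assms] by blast
  show ?thesis
    by (rule algebraic_int_stable_span[OF B(1,2)])
      (simp add: mult.assoc B int_module.span_base)
qed

text \<open>The determinant trick over the rationals: multiplication by \<open>x\<close> sends a
  finite rational spanning set \<open>B\<close> of \<open>K\<close> into \<open>K\<close>, hence
  into its own span.\<close>

lemma number_field_algebraic:
  assumes K: "number_field K" and x: "x \<in> K"
  shows "algebraic x"
proof -
  obtain B where B: "finite B" "B \<subseteq> K" "\<forall>x\<in>K. \<exists>c. x = (\<Sum>b\<in>B. of_rat (c b) * b)"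
    using K by (auto simp: number_field_def)
  have "1 \<in> K" using K by (simp add: number_field_def)
  then obtain c where c: "1 = (\<Sum>b\<in>B. of_rat (c b) * b)" using B by blast
  \<comment> \<open>\<open>B\<close> spans 1, so it cannot consist of 0 alone.\<close>
  then obtain b0 where b0: "b0 \<in> B" "b0 \<noteq> 0"
    by (metis (no_types, lifting) mult_zero_right sum.neutral zero_neq_one)
  have "\<forall>b\<in>B. \<exists>c. x * b = (\<Sum>b'\<in>B. of_rat (c b') * b')"
    using B x K by (auto simp: number_field_def)
  then obtain d where "\<And>b. b \<in> B \<Longrightarrow> x * b = (\<Sum>b'\<in>B. of_rat (d b b') * b')"
    by metis
  then obtain p where p: "lead_coeff p = 1" "poly (map_poly of_rat p) x = 0"
    using monic_root_of_stable_span[of of_rat B b0 x d] B b0 of_rat_hom.comm_ring_hom_axioms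
    by blast
  have "p \<noteq> 0" using p by auto
  then show ?thesis
    unfolding algebraic_altdef using p by (intro exI[of _ "map_poly of_rat p"]) (auto simp: coeff_map_poly map_poly_eq_0_iff)
qed

subsection \<open>Invertibility of finitely generated ideals\<close>

text \<open>The sum is a coefficient of the quotient of the polynomial by \<open>X - t\<close>. The
  span of \<open>t ^ k\<close> for \<open>k < n\<close> need not be stable under \<open>t\<close>,
  as the polynomial need not be monic, but it is stable under this sum: for \<open>k < j\<close> all
  exponents \<open>i - j + k\<close> stay below \<open>n\<close>, and for \<open>k \<ge> j\<close>
  the equation for \<open>t\<close> replaces the terms with \<open>i \<ge> j\<close> by those with
  \<open>i < j\<close>, whose exponents \<open>i + (k - j)\<close> are below
  \<open>k\<close>.\<close>

lemma synthetic_division_algebraic_int: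
  fixes t :: "'a::field_char_0" and c :: "nat \<Rightarrow> int"
  assumes root: "(\<Sum>i\<le>n. of_int (c i) * t ^ i) = 0" and n: "n > 0"
  shows "algebraic_int (\<Sum>i=j..n. of_int (c i) * t ^ (i - j))"
proof (rule algebraic_int_stable_span[of "(\<lambda>i. t ^ i) ` {..<n}"])
  let ?h = "\<Sum>i=j..n. of_int (c i) * t ^ (i - j)"
  let ?M = "int_module.span ((\<lambda>i. t ^ i) ` {..<n})"
  have M: "(\<Sum>i\<in>A. of_int (c i) * t ^ f i) \<in> ?M" if "\<And>i. i \<in> A \<Longrightarrow> f i < n" for A f
    using that by (intro int_module.span_sum int_module.span_scale int_module.span_base) auto
  fix b assume "b \<in> (\<lambda>i. t ^ i) ` {..<n}"
  then obtain k where k: "b = t ^ k" "k < n" by auto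
  show "?h * b \<in> ?M"
  proof (cases "k < j")
    case True
    have "?h * b = (\<Sum>i=j..n. of_int (c i) * t ^ (i - j + k))"
      unfolding k sum_distrib_right by (simp only: power_add mult.assoc)
    also have "\<dots> \<in> ?M" using True k by (intro M) auto
    finally show ?thesis .
  next
    case False
    \<comment> \<open>Here \<open>j \<le> k < n\<close>, so the minimum equals \<open>j\<close>;
      writing \<open>min\<close> makes the decomposition valid for every \<open>j\<close>.\<close>
    have "{..n} = {j..n} \<union> {..<min j (Suc n)}" by auto
    then have "(\<Sum>i\<le>n. of_int (c i) * t ^ i) =
        (\<Sum>i=j..n. of_int (c i) * t ^ i) + (\<Sum>i<min j (Suc n). of_int (c i) * t ^ i)"
      by (simp only:) (intro sum.union_disjoint, auto)
    then have "(\<Sum>i=j..n. of_int (c i) * t ^ i) = - (\<Sum>i<min j (Suc n). of_int (c i) * t ^ i)"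
      using root by (simp add: eq_neg_iff_add_eq_0)
    moreover have "?h * b = t ^ (k - j) * (\<Sum>i=j..n. of_int (c i) * t ^ i)"
    proof -
      have "t ^ (i - j) * t ^ k = t ^ (k - j) * t ^ i" if "i \<ge> j" for i
        using that False by (simp add: power_add[symmetric] add.commute)
      then show ?thesis
        by (auto simp: k sum_distrib_left sum_distrib_right mult_ac intro!: sum.cong)
    qed
    ultimately have "?h * b = - (\<Sum>i<min j (Suc n). of_int (c i) * t ^ (i + (k - j)))"
      by (simp add: sum_distrib_left power_add mult_ac)
    also have "\<dots> \<in> ?M" using False k by (intro int_module.span_neg M) auto
    finally show ?thesis .
  qed
qed (use n in \<open>auto intro!: image_eqI[of _ _ 0]\<close>)

section \<open>Primitive integer polynomials and Bezout relations\<close>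

lemma bezout_coeffs_int:
  fixes c :: "'i \<Rightarrow> int"
  assumes "finite A"
  obtains z where "(\<Sum>i\<in>A. z i * c i) = Gcd (c ` A)"
proof -
  have "\<exists>z. (\<Sum>i\<in>A. z i * c i) = Gcd (c ` A)"
    using assms
  proof (induction A)
    case empty
    then show ?case by simp
  next
    case (insert a A)
    then obtain z where z: "(\<Sum>i\<in>A. z i * c i) = Gcd (c ` A)" by blast
    obtain u v where uv: "u * c a + v * Gcd (c ` A) = gcd (c a) (Gcd (c ` A))"
      using bezout_int by blast
    have "(\<Sum>i\<in>A. (if i = a then u else v * z i) * c i) = v * (\<Sum>i\<in>A. z i * c i)"
      using insert by (auto simp: sum_distrib_left mult.assoc intro!: sum.cong)
    then have "(\<Sum>i\<in>insert a A. (if i = a then u else v * z i) * c i) = Gcd (c ` insert a A)"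
      using insert uv z by simp
    then show ?case by (rule exI[of _ "\<lambda>i. if i = a then u else v * z i"])
  qed
  then show ?thesis using that by blast
qed

text \<open>Dividing an integer polynomial by its nonzero content keeps the root \<open>t\<close>.
  For the primitive part, content 1 becomes a Bezout relation among the coefficients.\<close>

lemma primitive_int_root:
  fixes t :: "'a::field_char_0"
  assumes "algebraic t"
  obtains n and c z :: "nat \<Rightarrow> int" where "n > 0" "(\<Sum>i\<le>n. of_int (c i) * t ^ i) = 0"
    "(\<Sum>i\<le>n. z i * c i) = 1"
proof -
  obtain q where q: "q \<noteq> 0" "poly (map_poly of_int q) t = 0"
    using algebraicE'[OF assms] by blast
  define p where "p = primitive_part q"
  have qp: "q = Polynomial.smult (content q) p" by (simp add: p_def)
  then have "poly (map_poly of_int q) t = of_int (content q) * poly (map_poly of_int p) t"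
    by (metis of_int_hom.map_poly_hom_smult poly_smult)
  then have root: "poly (map_poly of_int p) t = 0" using q by simp
  then have r: "(\<Sum>i\<le>degree p. of_int (coeff p i) * t ^ i) = 0"
    by (simp add: poly_altdef coeff_map_poly)
  have cont: "content p = 1" using q by (simp add: p_def)
  obtain z where "(\<Sum>i\<le>degree p. z i * coeff p i) = Gcd (coeff p ` {..degree p})"
    using bezout_coeffs_int[of "{..degree p}" "coeff p"] by blast
  moreover have "Gcd (coeff p ` {..degree p}) = 1"
  proof -
    have "Gcd (coeff p ` {..degree p}) dvd content p"
      unfolding const_poly_dvd_iff_dvd_content[symmetric] const_poly_dvd_iff
    proof
      fix i
      show "Gcd (coeff p ` {..degree p}) dvd coeff p i"
        by (cases "i \<le> degree p") (auto intro!: Gcd_dvd simp: coeff_eq_0)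
    qed
    then show ?thesis using cont Gcd_int_greater_eq_0[of "coeff p ` {..degree p}"] by simp
  qed
  \<comment> \<open>A constant polynomial with a root is 0, whose content is not 1.\<close>
  moreover have "degree p > 0"
  proof (rule ccontr)
    assume "\<not> degree p > 0"
    then obtain a where a: "p = [:a:]" by (metis degree_eq_zeroE not_gr0)
    then show False using root cont by (auto simp: map_poly_pCons)
  qed
  ultimately show ?thesis using that r by metis
qed

text \<open>
  If \<open>c\<close> are the coefficients of a primitive integer polynomial with root \<open>t\<close> and \<open>h (j + 1)\<close> those
  of its quotient by \<open>X - t\<close>, then \<open>h j\<close> and \<open>t * h j\<close> are integral, so the \<open>h j\<close> lie in the
  inverse of the fractional ideal \<open>(1, t)\<close>; and \<open>c j = h j - t * h (j + 1)\<close> have no common divisor.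
\<close>

lemma invertible_one_t:
  fixes t :: "'a::field_char_0"
  assumes K: "number_field K" and t: "t \<in> K" "t \<noteq> 0"
  obtains v w where "v \<in> K" "w \<in> K" "v + w = 1"
    "algebraic_int v" "algebraic_int (v * t)" "algebraic_int w" "algebraic_int (w / t)"
proof -
  obtain n and c z :: "nat \<Rightarrow> int" where n: "n > 0"
    and root: "(\<Sum>i\<le>n. of_int (c i) * t ^ i) = 0" and z: "(\<Sum>i\<le>n. z i * c i) = 1"
    using primitive_int_root number_field_algebraic[OF K t(1)] by metis
  have K': "0 \<in> K" "1 \<in> K" "\<And>x y. x \<in> K \<Longrightarrow> y \<in> K \<Longrightarrow> x + y \<in> K"
    "\<And>x y. x \<in> K \<Longrightarrow> y \<in> K \<Longrightarrow> x * y \<in> K" "\<And>x. x \<in> K \<Longrightarrow> - x \<in> K"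
    using K by (auto simp: number_field_def)
  have Kint: "of_int k \<in> K" for k
  proof -
    have "of_nat m \<in> K" for m by (induction m) (auto intro: K')
    then show ?thesis by (cases k rule: int_cases2) (auto intro: K')
  qed
  have Kpow: "t ^ i \<in> K" for i by (induction i) (auto intro: K' t)
  have Ksum: "(\<And>i. i \<in> A \<Longrightarrow> f i \<in> K) \<Longrightarrow> sum f A \<in> K" for A and f :: "nat \<Rightarrow> 'a"
    by (induction A rule: infinite_finite_induct) (auto intro: K')
  define h where "h j = (\<Sum>i=j..n. of_int (c i) * t ^ (i - j))" for j
  have h: "algebraic_int (h j)" for j
    unfolding h_def by (rule synthetic_division_algebraic_int[OF root n])
  have hK: "h j \<in> K" for j
    unfolding h_def by (intro Ksum K' Kint Kpow)
  have c: "of_int (c j) = h j - t * h (Suc j)" if "j \<le> n" for j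
  proof -
    have "h j = of_int (c j) + (\<Sum>i=Suc j..n. of_int (c i) * t ^ (i - j))"
      using that by (simp add: h_def sum.atLeast_Suc_atMost)
    also have "(\<Sum>i=Suc j..n. of_int (c i) * t ^ (i - j)) = t * h (Suc j)"
      unfolding h_def sum_distrib_left
    proof (intro sum.cong refl)
      fix i assume "i \<in> {Suc j..n}"
      then have "t ^ (i - j) = t * t ^ (i - Suc j)"
        by (metis Suc_diff_Suc Suc_le_lessD atLeastAtMost_iff power_Suc)
      then show "of_int (c i) * t ^ (i - j) = t * (of_int (c i) * t ^ (i - Suc j))" by simp
    qed
    finally show ?thesis by simp
  qed
  have int: "algebraic_int (of_int k :: 'a)" for k by (intro int_imp_algebraic_int Ints_of_int)
  \<comment> \<open>For \<open>j > 0\<close> the recursion expresses \<open>t * h j\<close> as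
    \<open>h (j - 1)\<close> minus an integer. For \<open>j = 0\<close>, \<open>h 0\<close> is the
    value of the polynomial at its root \<open>t\<close>, hence 0.\<close>
  have th: "algebraic_int (t * h j)" if "j \<le> n" for j
  proof (cases j)
    case 0
    have "h 0 = 0" using root by (simp add: h_def atLeast0AtMost)
    then show ?thesis using 0 by simp
  next
    case (Suc i)
    then have "t * h j = h i + of_int (- c i)" using c[of i] that by simp
    then show ?thesis using algebraic_int_add[OF h int, of i "- c i"] by simp
  qed
  have alg_sum: "(\<And>i. i \<in> A \<Longrightarrow> algebraic_int (f i)) \<Longrightarrow> algebraic_int (sum f A)"
    for A and f :: "nat \<Rightarrow> 'a"
    by (induction A rule: infinite_finite_induct) (auto intro: algebraic_int_add)
  \<comment> \<open>Weighting the recursion with the Bezout coefficients gives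
    \<open>V - t * W = 1\<close>. The required pair is \<open>v = V\<close> and
    \<open>w = - (t * W)\<close>, so that \<open>w / t = - W\<close>.\<close>
  define V where "V = (\<Sum>j\<le>n. of_int (z j) * h j)"
  define W where "W = (\<Sum>j\<le>n. of_int (z j) * h (Suc j))"
  \<comment> \<open>The index runs up to \<open>n + 1\<close> here; \<open>h (Suc n)\<close> is an
    empty sum and so 0.\<close>
  have h_Suc: "algebraic_int (t * h (Suc j))" if "j \<le> n" for j
  proof (cases "j = n")
    case True
    then show ?thesis by (simp add: h_def)
  next
    case False
    then show ?thesis using th[of "Suc j"] that by simp
  qed
  have "of_int (\<Sum>i\<le>n. z i * c i) = V - t * W"
    unfolding V_def W_def of_int_sum sum_distrib_left sum_subtractf[symmetric]
    by (intro sum.cong) (simp_all add: c algebra_simps)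
  then have VW: "V + - (t * W) = 1" using z by simp
  have "algebraic_int V" unfolding V_def by (intro alg_sum algebraic_int_mult int h)
  moreover have "V * t = (\<Sum>j\<le>n. of_int (z j) * (t * h j))"
    by (simp add: V_def sum_distrib_left mult_ac)
  then have "algebraic_int (V * t)"
    by (simp only:) (intro alg_sum algebraic_int_mult[OF int] th, simp)
  moreover have "t * W = (\<Sum>j\<le>n. of_int (z j) * (t * h (Suc j)))"
    by (simp add: W_def sum_distrib_left mult_ac)
  then have "algebraic_int (t * W)"
    by (simp only:) (intro alg_sum algebraic_int_mult[OF int] h_Suc, simp)
  moreover have "algebraic_int W" unfolding W_def by (intro alg_sum algebraic_int_mult int h)
  moreover have "V \<in> K" unfolding V_def by (intro Ksum K' Kint hK)
  moreover have "- (t * W) \<in> K" unfolding W_def by (intro Ksum K' Kint hK t)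
  ultimately show ?thesis using that[OF _ _ VW] t by (simp add: algebraic_int_minus_iff)
qed

section \<open>Partitions of unity over the ring of integers\<close>

lemma ring_of_integers_simps [simp]:
  "x \<in> carrier (ring_of_integers K) \<longleftrightarrow> x \<in> K \<and> algebraic_int x"
  "x \<otimes>\<^bsub>ring_of_integers K\<^esub> y = x * y" "x \<oplus>\<^bsub>ring_of_integers K\<^esub> y = x + y"
  "\<one>\<^bsub>ring_of_integers K\<^esub> = 1" "\<zero>\<^bsub>ring_of_integers K\<^esub> = 0"
  by (simp_all add: ring_of_integers_def)

lemma ring_of_integers_domain:
  fixes K :: "'a::field_char_0 set"
  assumes "number_field K"
  shows "domain (ring_of_integers K)"
proof -
  have K: "0 \<in> K" "1 \<in> K" "\<And>x y. x \<in> K \<Longrightarrow> y \<in> K \<Longrightarrow> x + y \<in> K"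
    "\<And>x y. x \<in> K \<Longrightarrow> y \<in> K \<Longrightarrow> x * y \<in> K" "\<And>x. x \<in> K \<Longrightarrow> - x \<in> K"
    using assms by (auto simp: number_field_def)
  have "cring (ring_of_integers K)"
  proof (rule cringI)
    show "abelian_group (ring_of_integers K)"
      by (rule abelian_groupI)
        (use K in \<open>auto simp: algebraic_int_add add.assoc add.commute intro!: bexI[of _ "- _"]\<close>)
    show "comm_monoid (ring_of_integers K)"
      by (rule comm_monoidI) (use K in \<open>auto simp: algebraic_int_mult mult_ac\<close>)
  qed (simp add: algebra_simps)
  then show ?thesis by (intro domain.intro domain_axioms.intro) auto
qed

text \<open>The quotients \<open>u a / a\<close> lie in the inverse of the fractional ideal
  generated by \<open>A\<close>, and the sum of the products \<open>a * (u a / a)\<close> is 1: this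
  is invertibility of that ideal. The arithmetic is all in the case of two generators,
  \<open>invertible_one_t\<close>; induction on \<open>A\<close> glues these cases together.\<close>

lemma partition_of_unity:
  fixes K :: "'a::field_char_0 set"
  assumes K: "number_field K" and A: "finite A" "A \<noteq> {}" "A \<subseteq> K - {0}"
  shows "\<exists>u. (\<Sum>a\<in>A. u a) = 1 \<and> (\<forall>a\<in>A. \<forall>b\<in>A. u a * b / a \<in> carrier (ring_of_integers K))"
  using A
proof (induction A rule: finite_ne_induct)
  case (singleton a)
  interpret domain "ring_of_integers K" by (rule ring_of_integers_domain[OF K])
  show ?case using singleton one_closed by (intro exI[of _ "\<lambda>_. 1"]) simp
next
  case (insert a A)
  interpret R: domain "ring_of_integers K" by (rule ring_of_integers_domain[OF K])
  let ?R = "carrier (ring_of_integers K)"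
  have add: "x + y \<in> ?R" and mult: "x * y \<in> ?R" if "x \<in> ?R" "y \<in> ?R" for x y
    using R.a_closed[OF that] R.m_closed[OF that] by simp_all
  have sum: "(\<And>b. b \<in> B \<Longrightarrow> f b \<in> ?R) \<Longrightarrow> sum f B \<in> ?R" for f :: "'a \<Rightarrow> 'a" and B
    by (induction B rule: infinite_finite_induct)
      (use R.zero_closed add in \<open>auto simp del: ring_of_integers_simps(1)\<close>)
  have "A \<subseteq> K - {0}" using insert by simp
  then obtain u where u: "(\<Sum>b\<in>A. u b) = 1" "\<And>b d. b \<in> A \<Longrightarrow> d \<in> A \<Longrightarrow> u b * d / b \<in> ?R"
    using insert.IH by blast
  have uR: "u b \<in> ?R" if "b \<in> A" for b
  proof -
    have "b \<noteq> 0" using insert that by auto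
    then show ?thesis using u(2)[OF that that] by simp
  qed
  have "\<exists>v w. v + w = 1 \<and> v \<in> ?R \<and> v * a / b \<in> ?R \<and> w \<in> ?R \<and> w * b / a \<in> ?R" if b: "b \<in> A" for b
  proof -
    have ab: "a \<in> K" "a \<noteq> 0" "b \<in> K" "b \<noteq> 0" using insert b by auto
    have K': "x * y \<in> K" "inverse x \<in> K" if "x \<in> K" "y \<in> K" for x y
      using K that by (auto simp: number_field_def)
    \<comment> \<open>The ideal generated by \<open>a\<close> and \<open>b\<close> is
      \<open>b\<close> times the one generated by 1 and \<open>t = a / b\<close>.\<close>
    have t: "a / b \<in> K" "a / b \<noteq> 0" "b / a \<in> K" using ab K' by (auto simp: divide_inverse)
    obtain v w where vw: "v \<in> K" "w \<in> K" "v + w = 1" "algebraic_int v"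
      "algebraic_int (v * (a / b))" "algebraic_int w" "algebraic_int (w / (a / b))"
      using invertible_one_t[OF K t(1,2)] by blast
    then show ?thesis using K'[OF vw(1) t(1)] K'[OF vw(2) t(3)]
      by (intro exI[of _ v] exI[of _ w]) (simp add: ab)
  qed
  then obtain v w where vw: "\<And>b. b \<in> A \<Longrightarrow> v b + w b = 1" "\<And>b. b \<in> A \<Longrightarrow> v b \<in> ?R"
    "\<And>b. b \<in> A \<Longrightarrow> v b * a / b \<in> ?R" "\<And>b. b \<in> A \<Longrightarrow> w b \<in> ?R"
    "\<And>b. b \<in> A \<Longrightarrow> w b * b / a \<in> ?R"
    by metis
  \<comment> \<open>Each old weight \<open>u b\<close> splits as
    \<open>u b * v b + u b * w b\<close>; the first part stays at \<open>b\<close>, the second parts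
    are collected at the new generator \<open>a\<close>.\<close>
  define u' where "u' b = (if b = a then \<Sum>d\<in>A. u d * w d else u b * v b)" for b
  have "u' b = u b * v b" if "b \<in> A" for b using insert that by (auto simp: u'_def)
  then have "(\<Sum>b\<in>insert a A. u' b) = (\<Sum>d\<in>A. u d * w d) + (\<Sum>b\<in>A. u b * v b)"
    using insert.hyps by (simp add: u'_def)
  also have "\<dots> = (\<Sum>b\<in>A. u b * (v b + w b))"
    by (simp add: sum.distrib algebra_simps)
  also have "\<dots> = 1" using u vw by simp
  finally have 1: "(\<Sum>b\<in>insert a A. u' b) = 1" .
  have a0: "a \<noteq> 0" and A0: "\<And>b. b \<in> A \<Longrightarrow> b \<noteq> 0 \<and> b \<noteq> a" using insert by auto
  have "u' b * d / b \<in> ?R" if "b \<in> insert a A" "d \<in> insert a A" for b d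
  proof (cases "b = a")
    case ba: True
    show ?thesis
    proof (cases "d = a")
      case True
      then show ?thesis using ba a0 uR vw sum[of A "\<lambda>d. u d * w d"] mult
        by (simp add: u'_def del: ring_of_integers_simps(1))
    next
      case False
      \<comment> \<open>Each term is routed through \<open>c\<close>: the induction hypothesis
        handles \<open>u c * d / c\<close>, the choice of \<open>w\<close> handles
        \<open>w c * c / a\<close>.\<close>
      have "u' b * d / b = (\<Sum>c\<in>A. (u c * d / c) * (w c * c / a))"
        using ba A0 by (auto simp: u'_def sum_distrib_right sum_divide_distrib intro!: sum.cong)
      also have "\<dots> \<in> ?R" using False that by (intro sum mult u vw) auto
      finally show ?thesis .
    qed
  next
    case ba: False
    then have b: "b \<in> A" using that by simp
    show ?thesis
    proof (cases "d = a")
      case True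
      then have "u' b * d / b = u b * (v b * a / b)" using ba by (simp add: u'_def)
      then show ?thesis using mult[OF uR[OF b] vw(3)[OF b]] by (simp only:)
    next
      case False
      then have "d \<in> A" using that by simp
      have "u' b * d / b = (u b * d / b) * v b" using ba by (simp add: u'_def)
      then show ?thesis using mult[OF u(2)[OF b \<open>d \<in> A\<close>] vw(2)[OF b]] by (simp only:)
    qed
  qed
  then show ?case using 1 by blast
qed

subsection \<open>Extension of ideals\<close>

locale number_ring_hom =
  fixes K :: "'a::field_char_0 set" and L :: "'b::field_char_0 set" and \<alpha> :: "'a \<Rightarrow> 'b"
    and R :: "'a ring" and S :: "'b ring"
  defines R_def: "R \<equiv> ring_of_integers K" and S_def: "S \<equiv> ring_of_integers L"
  assumes K: "number_field K" and L: "number_field L"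
    and hom: "\<alpha> \<in> ring_hom R S" and inj: "inj_on \<alpha> (carrier R)"
begin

sublocale R: domain R unfolding R_def by (rule ring_of_integers_domain[OF K])
sublocale S: domain S unfolding S_def by (rule ring_of_integers_domain[OF L])
sublocale ring_hom_cring R S \<alpha>
  by (intro ring_hom_cring.intro ring_hom_cring_axioms.intro R.cring_axioms S.cring_axioms hom)

section \<open>Computing with \<alpha> inside the ambient fields\<close>

lemma ops [simp]:
  "x \<otimes>\<^bsub>R\<^esub> y = x * y" "x \<oplus>\<^bsub>R\<^esub> y = x + y" "\<one>\<^bsub>R\<^esub> = 1" "\<zero>\<^bsub>R\<^esub> = 0"
  "x' \<otimes>\<^bsub>S\<^esub> y' = x' * y'" "x' \<oplus>\<^bsub>S\<^esub> y' = x' + y'" "\<one>\<^bsub>S\<^esub> = 1" "\<zero>\<^bsub>S\<^esub> = 0"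
  by (simp_all add: R_def S_def)

lemmas R_ops = R.a_closed[unfolded ops] R.m_closed[unfolded ops] R.one_closed[unfolded ops]
  R.zero_closed[unfolded ops]
lemmas S_ops = S.a_closed[unfolded ops] S.m_closed[unfolded ops] S.one_closed[unfolded ops]
  S.zero_closed[unfolded ops]
lemmas \<alpha>_simps = hom_closed hom_add[unfolded ops] hom_mult[unfolded ops] hom_one[unfolded ops]
  hom_zero[unfolded ops]

lemma R_sum: "(\<And>b. b \<in> B \<Longrightarrow> f b \<in> carrier R) \<Longrightarrow> sum f B \<in> carrier R"
  by (induction B rule: infinite_finite_induct) (auto intro: R_ops)

lemma S_sum: "(\<And>b. b \<in> B \<Longrightarrow> f b \<in> carrier S) \<Longrightarrow> sum f B \<in> carrier S"
  by (induction B rule: infinite_finite_induct) (auto intro: S_ops)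

lemma \<alpha>_sum: "(\<And>b. b \<in> B \<Longrightarrow> f b \<in> carrier R) \<Longrightarrow> \<alpha> (sum f B) = (\<Sum>b\<in>B. \<alpha> (f b))"
  by (induction B rule: infinite_finite_induct) (auto simp: \<alpha>_simps R_sum)

lemma \<alpha>_power: "x \<in> carrier R \<Longrightarrow> x ^ n \<in> carrier R \<and> \<alpha> (x ^ n) = \<alpha> x ^ n"
  by (induction n) (auto simp: \<alpha>_simps R_ops)

lemma of_int_R: "of_int k \<in> carrier R \<and> \<alpha> (of_int k) = of_int k"
proof -
  have nat: "of_nat n \<in> carrier R \<and> \<alpha> (of_nat n) = of_nat n" for n
    by (induction n) (auto simp: \<alpha>_simps R_ops)
  have "- 1 \<in> carrier R" using K by (auto simp: R_def number_field_def)
  moreover from this have "\<alpha> (- 1) + \<alpha> 1 = \<alpha> (- 1 + 1)" by (metis R_ops(3) \<alpha>_simps(2))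
  then have "\<alpha> (- 1) = - 1" by (simp add: \<alpha>_simps eq_neg_iff_add_eq_0)
  ultimately show ?thesis
    using nat R_ops(2)[of "- 1"] \<alpha>_simps(3)[of "- 1"] by (cases k rule: int_cases2) (force+)
qed

lemma \<alpha>_eq_0: "x \<in> carrier R \<Longrightarrow> \<alpha> x = 0 \<longleftrightarrow> x = 0"
  using inj_onD[OF inj, of x 0] by (auto simp: \<alpha>_simps R_ops)

text \<open>The quotient \<open>y / a\<close> satisfies the same monic integer equation
  \<open>p\<close> as \<open>s\<close>, hence is integral. Since \<alpha> is a homomorphism on
  \<open>R\<close> only, the equation is homogenized in \<open>y\<close> and \<open>a\<close>; the
  image of this element of \<open>R\<close> is \<open>\<alpha> a ^ degree p\<close> times the value
  of \<open>p\<close> at \<open>s\<close>, which is 0, and injectivity does the rest.\<close>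

lemma divides_reflect:
  assumes y: "y \<in> carrier R" and a: "a \<in> carrier R" "a \<noteq> 0"
    and s: "s \<in> carrier S" "\<alpha> y = \<alpha> a * s"
  shows "y / a \<in> carrier R"
proof -
  have "algebraic_int s" using s by (simp add: S_def)
  then obtain p where p: "poly (map_poly of_int p) s = 0" "lead_coeff p = 1"
    by (auto simp: algebraic_int_altdef_ipoly)
  let ?n = "degree p"
  have in_R: "of_int (coeff p i) * y ^ i * a ^ (?n - i) \<in> carrier R" for i
    by (intro R_ops) (use \<alpha>_power y a of_int_R in auto)
  have "\<alpha> (\<Sum>i\<le>?n. of_int (coeff p i) * y ^ i * a ^ (?n - i)) =
      (\<Sum>i\<le>?n. of_int (coeff p i) * \<alpha> y ^ i * \<alpha> a ^ (?n - i))"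
    unfolding \<alpha>_sum[OF in_R] using \<alpha>_power y a of_int_R
    by (intro sum.cong) (auto simp: \<alpha>_simps R_ops)
  also have "\<dots> = (\<Sum>i\<le>?n. \<alpha> a ^ ?n * (of_int (coeff p i) * s ^ i))"
  proof (intro sum.cong refl)
    fix i assume "i \<in> {..?n}"
    then have "\<alpha> a ^ ?n = \<alpha> a ^ i * \<alpha> a ^ (?n - i)" by (simp add: power_add[symmetric])
    then show "of_int (coeff p i) * \<alpha> y ^ i * \<alpha> a ^ (?n - i) =
        \<alpha> a ^ ?n * (of_int (coeff p i) * s ^ i)"
      by (simp add: s(2) power_mult_distrib mult_ac)
  qed
  also have "\<dots> = \<alpha> a ^ ?n * poly (map_poly of_int p) s"
    by (simp add: poly_altdef coeff_map_poly sum_distrib_left)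
  finally have "(\<Sum>i\<le>?n. of_int (coeff p i) * y ^ i * a ^ (?n - i)) = 0"
    using p(1) \<alpha>_eq_0[OF R_sum, of "{..?n}" "\<lambda>i. of_int (coeff p i) * y ^ i * a ^ (?n - i)"] in_R
    by simp
  moreover have "(\<Sum>i\<le>?n. of_int (coeff p i) * y ^ i * a ^ (?n - i)) =
      a ^ ?n * poly (map_poly of_int p) (y / a)"
  proof -
    have "a ^ (?n - i) = a ^ ?n / a ^ i" if "i \<le> ?n" for i
      using that a by (simp add: power_diff)
    then show ?thesis
      by (simp add: poly_altdef coeff_map_poly sum_distrib_left power_divide mult_ac)
  qed
  ultimately have "poly (map_poly of_int p) (y / a) = 0" using a by simp
  then have "algebraic_int (y / a)" using p by (auto simp: algebraic_int_altdef_ipoly)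
  moreover have "y / a \<in> K" using y a K by (simp add: R_def number_field_def divide_inverse)
  ultimately show ?thesis by (simp add: R_def)
qed

section \<open>Elements of an extended ideal\<close>

lemma extended_ideal: "ideal I R \<Longrightarrow> ideal (Idl\<^bsub>S\<^esub> (\<alpha> ` I)) S"
  by (rule S.genideal_ideal) (auto simp: ideal.Icarr)

lemma extended_ideal_base: "ideal I R \<Longrightarrow> x \<in> I \<Longrightarrow> \<alpha> x \<in> Idl\<^bsub>S\<^esub> (\<alpha> ` I)"
  by (rule subsetD[OF S.genideal_self]) (auto simp: ideal.Icarr)

lemma extended_ideal_mult:
  assumes "ideal I R" "x \<in> I" "s \<in> carrier S"
  shows "\<alpha> x * s \<in> Idl\<^bsub>S\<^esub> (\<alpha> ` I)"
  using ideal.I_r_closed[OF extended_ideal extended_ideal_base, OF assms(1,1,2,3)] by simp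

lemma S_ideal_sum:
  assumes "ideal J S" "\<And>b. b \<in> B \<Longrightarrow> f b \<in> J"
  shows "sum f B \<in> J"
proof -
  interpret J: ideal J S by fact
  show ?thesis using assms(2)
    by (induction B rule: infinite_finite_induct)
      (use J.zero_closed J.a_closed in auto)
qed

text \<open>The finite combinations form an ideal \<open>M\<close> of \<open>S\<close> containing
  the image of \<open>I\<close>, and the generated ideal is the least such ideal.\<close>

lemma extended_ideal_elem:
  assumes I: "ideal I R" and y: "y \<in> Idl\<^bsub>S\<^esub> (\<alpha> ` I)"
  obtains A s where "finite A" "A \<subseteq> I" "\<And>a. s a \<in> carrier S" "y = (\<Sum>a\<in>A. \<alpha> a * s a)"
proof -
  interpret I: ideal I R by fact
  define M where "M = {y. \<exists>A s. finite A \<and> A \<subseteq> I \<and> (\<forall>a. s a \<in> carrier S) \<and> y = (\<Sum>a\<in>A. \<alpha> a * s a)}"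
  have M_carrier: "M \<subseteq> carrier S"
    by (auto simp: M_def intro!: S_sum S_ops hom_closed)
  have M_mult: "r * y \<in> M" if yr: "y \<in> M" "r \<in> carrier S" for r y
  proof -
    obtain A s where A: "finite A" "A \<subseteq> I" "\<forall>a. s a \<in> carrier S" "y = (\<Sum>a\<in>A. \<alpha> a * s a)"
      using yr(1) unfolding M_def by (elim CollectE exE conjE)
    then have "r * y = (\<Sum>a\<in>A. \<alpha> a * (r * s a))"
      by (simp add: sum_distrib_left mult_ac)
    then show ?thesis using A(1-3) yr(2) unfolding M_def
      by (intro CollectI exI[of _ A] exI[of _ "\<lambda>a. r * s a"]) (simp add: S_ops)
  qed
  have M_add: "y + z \<in> M" if yz: "y \<in> M" "z \<in> M" for y z
  proof -
    obtain A s where A: "finite A" "A \<subseteq> I" "\<forall>a. s a \<in> carrier S" "y = (\<Sum>a\<in>A. \<alpha> a * s a)"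
      using yz(1) unfolding M_def by (elim CollectE exE conjE)
    obtain B t where B: "finite B" "B \<subseteq> I" "\<forall>a. t a \<in> carrier S" "z = (\<Sum>a\<in>B. \<alpha> a * t a)"
      using yz(2) unfolding M_def by (elim CollectE exE conjE)
    \<comment> \<open>Both coefficient families are extended by 0, so that the two sums can run over
      the union of the index sets.\<close>
    define r where "r a = (if a \<in> A then s a else 0) + (if a \<in> B then t a else 0)" for a
    have "y = (\<Sum>a\<in>A \<union> B. \<alpha> a * (if a \<in> A then s a else 0))"
      unfolding A(4) by (rule sum.mono_neutral_cong_left) (use A B in auto)
    moreover have "z = (\<Sum>a\<in>A \<union> B. \<alpha> a * (if a \<in> B then t a else 0))"
      unfolding B(4) by (rule sum.mono_neutral_cong_left) (use A B in auto)
    ultimately have "y + z = (\<Sum>a\<in>A \<union> B. \<alpha> a * r a)"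
      by (simp add: r_def sum.distrib distrib_left)
    moreover have "\<forall>a. r a \<in> carrier S" using A B by (auto simp: r_def S_ops)
    ultimately show ?thesis
      unfolding M_def using A B by (intro CollectI exI[of _ "A \<union> B"] exI[of _ r]) auto
  qed
  have "ideal M S"
  proof (rule idealI[OF S.ring_axioms])
    show "subgroup M (add_monoid S)"
    proof (rule group.subgroupI[OF S.a_group])
      show "M \<noteq> {}" unfolding M_def using S_ops(4) by (auto intro!: exI[of _ "{}"])
      show "inv\<^bsub>add_monoid S\<^esub> y \<in> M" if "y \<in> M" for y
      proof -
        have "y \<in> carrier S" using M_carrier that by auto
        then have "\<ominus>\<^bsub>S\<^esub> y = (\<ominus>\<^bsub>S\<^esub> \<one>\<^bsub>S\<^esub>) \<otimes>\<^bsub>S\<^esub> y" by algebra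
        then have "\<ominus>\<^bsub>S\<^esub> y \<in> M"
          using M_mult[OF that S.a_inv_closed[OF S.one_closed]] by simp
        then show ?thesis by (simp add: a_inv_def)
      qed
    qed (use M_carrier M_add in auto)
  qed (use M_mult in \<open>auto simp: mult.commute\<close>)
  moreover have "\<alpha> ` I \<subseteq> M"
  proof
    fix y assume "y \<in> \<alpha> ` I"
    then obtain a where "a \<in> I" "y = \<alpha> a" by auto
    then show "y \<in> M"
      unfolding M_def using S_ops(3)
      by (intro CollectI exI[of _ "{a}"] exI[of _ "\<lambda>_. 1"]) auto
  qed
  ultimately have "y \<in> M" using S.genideal_minimal y by blast
  then obtain A s where "finite A" "A \<subseteq> I" "\<forall>a. s a \<in> carrier S" "y = (\<Sum>a\<in>A. \<alpha> a * s a)"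
    unfolding M_def by (elim CollectE exE conjE)
  then show ?thesis by (intro that[of A s]) simp_all
qed

text \<open>Localization without fractions of \<open>S\<close>: after multiplication by
  \<open>\<alpha> (u a)\<close>, every generator \<open>b\<close> of \<open>y\<close> becomes
  divisible by \<open>a\<close>, because \<open>u a * b / a\<close> lies in \<open>R\<close>. As the
  weights sum to 1, membership of \<open>y\<close> in an ideal can be tested on these
  multiples.\<close>

lemma extended_ideal_local:
  assumes nz: "nz_ideal R I" and y: "y \<in> Idl\<^bsub>S\<^esub> (\<alpha> ` I)"
  obtains A u s where "finite A" "A \<subseteq> I - {0}" "(\<Sum>a\<in>A. u a) = 1"
    "\<And>a. a \<in> A \<Longrightarrow> u a \<in> carrier R" "\<And>a. a \<in> A \<Longrightarrow> s a \<in> carrier S"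
    "\<And>a. a \<in> A \<Longrightarrow> \<alpha> (u a) * y = \<alpha> a * s a"
proof -
  have I: "ideal I R" using nz by (simp add: nz_ideal_def)
  interpret I: ideal I R by fact
  obtain A s where A: "finite A" "A \<subseteq> I" "\<And>a. s a \<in> carrier S" "y = (\<Sum>a\<in>A. \<alpha> a * s a)"
    using extended_ideal_elem[OF I y] by blast
  obtain c where c: "c \<in> I" "c \<noteq> 0" using nz I.zero_closed by (auto simp: nz_ideal_def)
  \<comment> \<open>The nonzero element \<open>c\<close> keeps the index set nonempty even for
    \<open>y = 0\<close>; it gets coefficient 0 unless it already occurs in
    \<open>A\<close>.\<close>
  define B where "B = insert c (A - {0})"
  define t where "t a = (if a \<in> A then s a else 0)" for a
  have B: "finite B" "B \<noteq> {}" "B \<subseteq> I - {0}" using A c by (auto simp: B_def)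
  have t: "t a \<in> carrier S" for a using A by (simp add: t_def S_ops)
  have y: "y = (\<Sum>b\<in>B. \<alpha> b * t b)"
  proof -
    have "y = (\<Sum>a\<in>A - {0}. \<alpha> a * s a)"
      unfolding A(4) by (rule sum.mono_neutral_right) (use A in \<open>auto simp: \<alpha>_simps\<close>)
    also have "\<dots> = (\<Sum>b\<in>B. \<alpha> b * t b)"
      by (rule sum.mono_neutral_cong_left) (use A c in \<open>auto simp: B_def t_def\<close>)
    finally show ?thesis .
  qed
  have BR: "B \<subseteq> carrier R" using B I.Icarr by auto
  then have "B \<subseteq> K - {0}" using B by (auto simp: R_def)
  then obtain u where u: "(\<Sum>a\<in>B. u a) = 1" "\<And>a b. a \<in> B \<Longrightarrow> b \<in> B \<Longrightarrow> u a * b / a \<in> carrier R"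
    using partition_of_unity[OF K B(1,2)] unfolding R_def by blast
  have uR: "u a \<in> carrier R" if "a \<in> B" for a
  proof -
    have "a \<noteq> 0" using B that by auto
    then show ?thesis using u(2)[OF that that] by simp
  qed
  define r where "r a = (\<Sum>b\<in>B. \<alpha> (u a * b / a) * t b)" for a
  have "\<alpha> (u a) * y = \<alpha> a * r a" if a: "a \<in> B" for a
  proof -
    have "\<alpha> (u a) * \<alpha> b = \<alpha> a * \<alpha> (u a * b / a)" if b: "b \<in> B" for b
    proof -
      have "\<alpha> a * \<alpha> (u a * b / a) = \<alpha> (a * (u a * b / a))"
        using \<alpha>_simps(3)[OF subsetD[OF BR a] u(2)[OF a b]] by (rule sym)
      also have "a * (u a * b / a) = u a * b" using a B by auto
      finally show ?thesis using uR[OF a] b BR by (auto simp: \<alpha>_simps)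
    qed
    then have "\<alpha> (u a) * (\<alpha> b * t b) = \<alpha> a * (\<alpha> (u a * b / a) * t b)" if "b \<in> B" for b
      using that by (metis mult.assoc)
    then show ?thesis unfolding y r_def sum_distrib_left by (intro sum.cong) auto
  qed
  moreover have "r a \<in> carrier S" if "a \<in> B" for a
    unfolding r_def using u(2) t that by (intro S_sum S_ops hom_closed) auto
  ultimately show ?thesis using that[OF B(1,3) u(1) uR] by blast
qed

text \<open>Needed for the relation \<open>u_e_notin\<close>: an element outside \<open>I\<close>
  must stay outside the extended ideal. By \<open>divides_reflect\<close>, each local multiple
  \<open>u a * x\<close> is divisible by \<open>a\<close> in \<open>R\<close> and so lies in
  \<open>I\<close>; these multiples add up to \<open>x\<close>.\<close>

lemma extended_ideal_contract:
  assumes nz: "nz_ideal R I" and x: "x \<in> carrier R" and \<alpha>x: "\<alpha> x \<in> Idl\<^bsub>S\<^esub> (\<alpha> ` I)"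
  shows "x \<in> I"
proof -
  interpret I: ideal I R using nz by (simp add: nz_ideal_def)
  obtain A u s where A: "finite A" "A \<subseteq> I - {0}" "(\<Sum>a\<in>A. u a) = 1"
    "\<And>a. a \<in> A \<Longrightarrow> u a \<in> carrier R" "\<And>a. a \<in> A \<Longrightarrow> s a \<in> carrier S"
    "\<And>a. a \<in> A \<Longrightarrow> \<alpha> (u a) * \<alpha> x = \<alpha> a * s a"
    using extended_ideal_local[OF nz \<alpha>x] by blast
  have "u a * x \<in> I" if a: "a \<in> A" for a
  proof -
    have a': "a \<in> I" "a \<noteq> 0" using A a by auto
    have "u a * x / a \<in> carrier R"
      by (rule divides_reflect[of _ _ "s a"]) (use A a a' x I.Icarr in \<open>auto simp: R_ops \<alpha>_simps\<close>)
    then have "u a * x / a * a \<in> I" using I.I_l_closed[OF a'(1), unfolded ops] by blast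
    then show ?thesis using a' by simp
  qed
  then have "(\<Sum>a\<in>B. u a * x) \<in> I" if "B \<subseteq> A" for B
    using that by (induction B rule: infinite_finite_induct) (use I.zero_closed I.a_closed in auto)
  then have "(\<Sum>a\<in>A. u a * x) \<in> I" by blast
  then show ?thesis using A(3) by (simp add: sum_distrib_right[symmetric])
qed

text \<open>The case of principal ideals. With weights \<open>u a + u b = 1\<close>, both
  \<open>u a * b\<close> and \<open>u b * a\<close> are common multiples of \<open>a\<close> and
  \<open>b\<close> in \<open>R\<close>, hence lie in \<open>I \<inter> J\<close>. Expanding
  \<open>z = \<alpha> (u a) * z + \<alpha> (u b) * z\<close>, with \<open>\<alpha> b * t\<close> for
  the first \<open>z\<close> and \<open>\<alpha> a * s\<close> for the second, puts \<open>z\<close>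
  into the extension.\<close>

lemma common_multiple_extended:
  assumes I: "ideal I R" "a \<in> I" "a \<noteq> 0" and J: "ideal J R" "b \<in> J" "b \<noteq> 0"
    and s: "s \<in> carrier S" "z = \<alpha> a * s" and t: "t \<in> carrier S" "z = \<alpha> b * t"
  shows "z \<in> Idl\<^bsub>S\<^esub> (\<alpha> ` (I \<inter> J))"
proof (cases "a = b")
  \<comment> \<open>The weights are indexed by the set \<open>{a, b}\<close>, so equal generators
    are treated apart; then \<open>a\<close> itself lies in \<open>I \<inter> J\<close>.\<close>
  case True
  then show ?thesis
    using assms by (auto intro!: extended_ideal_mult R.i_intersect)
next
  case False
  interpret I: ideal I R by fact
  interpret J: ideal J R by fact
  have ab: "a \<in> carrier R" "b \<in> carrier R" using I J I.Icarr J.Icarr by auto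
  have "{a, b} \<subseteq> K - {0}" using ab I J by (auto simp: R_def)
  then obtain u where u: "(\<Sum>c\<in>{a, b}. u c) = 1"
    "\<And>c d. c \<in> {a, b} \<Longrightarrow> d \<in> {a, b} \<Longrightarrow> u c * d / c \<in> carrier R"
    using partition_of_unity[OF K, of "{a, b}"] unfolding R_def by blast
  have u1: "u a + u b = 1" using u(1) False by simp
  have uR: "u a \<in> carrier R" "u b \<in> carrier R"
    using u(2)[of a a] u(2)[of b b] I J by auto
  have "u a * b \<in> I" using I.I_l_closed[OF I(2) u(2)[of a b]] I by simp
  moreover have "u a * b \<in> J" using J.I_l_closed[OF J(2) uR(1)] by simp
  moreover have "u b * a \<in> J" using J.I_l_closed[OF J(2) u(2)[of b a]] J by simp
  moreover have "u b * a \<in> I" using I.I_l_closed[OF I(2) uR(2)] by simp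
  ultimately have "\<alpha> (u a * b) * t \<in> Idl\<^bsub>S\<^esub> (\<alpha> ` (I \<inter> J))" "\<alpha> (u b * a) * s \<in> Idl\<^bsub>S\<^esub> (\<alpha> ` (I \<inter> J))"
    using s t I J by (auto intro!: extended_ideal_mult R.i_intersect)
  then have "\<alpha> (u a * b) * t + \<alpha> (u b * a) * s \<in> Idl\<^bsub>S\<^esub> (\<alpha> ` (I \<inter> J))"
    using additive_subgroup.a_closed[OF ideal.axioms(1)[OF extended_ideal[OF R.i_intersect[OF I(1) J(1)]]]]
    by simp
  also have "\<alpha> (u a * b) * t + \<alpha> (u b * a) * s = \<alpha> (u a) * z + \<alpha> (u b) * z"
    using uR ab by (subst s(2), subst t(2)) (simp add: \<alpha>_simps mult.assoc)
  also have "\<dots> = \<alpha> (u a + u b) * z" using uR by (simp add: \<alpha>_simps distrib_right)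
  finally show ?thesis by (simp add: u1 \<alpha>_simps)
qed

text \<open>An instance of flatness of \<open>S\<close> over \<open>R\<close>. One inclusion is
  monotonicity; for the other, localizing at generators of \<open>I\<close> and of \<open>J\<close>
  leaves the case of principal ideals.\<close>

lemma extended_ideal_inter:
  assumes I: "nz_ideal R I" and J: "nz_ideal R J"
  shows "Idl\<^bsub>S\<^esub> (\<alpha> ` (I \<inter> J)) = Idl\<^bsub>S\<^esub> (\<alpha> ` I) \<inter> Idl\<^bsub>S\<^esub> (\<alpha> ` J)"
proof
  have IJ: "ideal I R" "ideal J R" using I J by (auto simp: nz_ideal_def)
  show "Idl\<^bsub>S\<^esub> (\<alpha> ` (I \<inter> J)) \<subseteq> Idl\<^bsub>S\<^esub> (\<alpha> ` I) \<inter> Idl\<^bsub>S\<^esub> (\<alpha> ` J)"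
    using IJ by (intro S.genideal_minimal S.i_intersect) (auto intro: extended_ideal extended_ideal_base)
  show "Idl\<^bsub>S\<^esub> (\<alpha> ` I) \<inter> Idl\<^bsub>S\<^esub> (\<alpha> ` J) \<subseteq> Idl\<^bsub>S\<^esub> (\<alpha> ` (I \<inter> J))"
  proof
    fix y assume y: "y \<in> Idl\<^bsub>S\<^esub> (\<alpha> ` I) \<inter> Idl\<^bsub>S\<^esub> (\<alpha> ` J)"
    obtain A u s where A: "finite A" "A \<subseteq> I - {0}" "(\<Sum>a\<in>A. u a) = 1"
      "\<And>a. a \<in> A \<Longrightarrow> u a \<in> carrier R" "\<And>a. a \<in> A \<Longrightarrow> s a \<in> carrier S"
      "\<And>a. a \<in> A \<Longrightarrow> \<alpha> (u a) * y = \<alpha> a * s a"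
      using extended_ideal_local[OF I] y by blast
    obtain B v t where B: "finite B" "B \<subseteq> J - {0}" "(\<Sum>a\<in>B. v a) = 1"
      "\<And>a. a \<in> B \<Longrightarrow> v a \<in> carrier R" "\<And>a. a \<in> B \<Longrightarrow> t a \<in> carrier S"
      "\<And>a. a \<in> B \<Longrightarrow> \<alpha> (v a) * y = \<alpha> a * t a"
      using extended_ideal_local[OF J] y by blast
    have part: "(\<Sum>a\<in>A. \<alpha> (u a)) = 1" "(\<Sum>b\<in>B. \<alpha> (v b)) = 1"
      using \<alpha>_sum[of A u] \<alpha>_sum[of B v] A B by (simp_all add: \<alpha>_simps)
    \<comment> \<open>The products \<open>u a * v b\<close> form a common refinement of the two
      partitions of unity, and each makes \<open>y\<close> a multiple of both
      \<open>\<alpha> a\<close> and \<open>\<alpha> b\<close>.\<close>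
    have "\<alpha> (u a) * \<alpha> (v b) * y \<in> Idl\<^bsub>S\<^esub> (\<alpha> ` (I \<inter> J))" if ab: "a \<in> A" "b \<in> B" for a b
    proof (rule common_multiple_extended[of I a J b "\<alpha> (v b) * s a" _ "\<alpha> (u a) * t b"])
      show "\<alpha> (u a) * \<alpha> (v b) * y = \<alpha> a * (\<alpha> (v b) * s a)"
        using A(6)[OF ab(1)] by (metis mult.assoc mult.commute)
      show "\<alpha> (u a) * \<alpha> (v b) * y = \<alpha> b * (\<alpha> (u a) * t b)"
        using B(6)[OF ab(2)] by (metis mult.assoc mult.commute)
    qed (use A B IJ ab in \<open>auto simp: S_ops\<close>)
    then have "(\<Sum>a\<in>A. \<Sum>b\<in>B. \<alpha> (u a) * \<alpha> (v b) * y) \<in> Idl\<^bsub>S\<^esub> (\<alpha> ` (I \<inter> J))"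
      using IJ by (intro S_ideal_sum extended_ideal R.i_intersect)
    also have "(\<Sum>a\<in>A. \<Sum>b\<in>B. \<alpha> (u a) * \<alpha> (v b) * y) = (\<Sum>a\<in>A. \<alpha> (u a)) * (\<Sum>b\<in>B. \<alpha> (v b)) * y"
      unfolding sum_product by (simp only: sum_distrib_right)
    finally show "y \<in> Idl\<^bsub>S\<^esub> (\<alpha> ` (I \<inter> J))" by (simp add: part)
  qed
qed

section \<open>Remaining ideal operations and transport of the relations\<close>

lemma extended_ideal_nz:
  assumes "nz_ideal R I"
  shows "nz_ideal S (Idl\<^bsub>S\<^esub> (\<alpha> ` I))"
proof -
  interpret I: ideal I R using assms by (simp add: nz_ideal_def)
  obtain x where x: "x \<in> I" "x \<noteq> 0" using assms I.zero_closed by (auto simp: nz_ideal_def)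
  then have "\<alpha> x \<noteq> 0" using \<alpha>_eq_0 I.Icarr by blast
  then show ?thesis
    using extended_ideal_base[OF I.is_ideal x(1)] extended_ideal[OF I.is_ideal]
    by (auto simp: nz_ideal_def)
qed

lemma extended_ideal_carrier: "Idl\<^bsub>S\<^esub> (\<alpha> ` carrier R) = carrier S"
  using ideal.one_imp_carrier[OF extended_ideal[OF R.oneideal]]
    extended_ideal_base[OF R.oneideal R.one_closed] by (simp add: \<alpha>_simps)

lemma extended_ideal_times:
  assumes a: "a \<in> carrier R" "a \<noteq> 0" and I: "nz_ideal R I"
  shows "Idl\<^bsub>S\<^esub> (\<alpha> ` (\<lambda>x. a * x) ` I) = (\<lambda>y. \<alpha> a * y) ` (Idl\<^bsub>S\<^esub> (\<alpha> ` I))"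
proof
  have id: "ideal I R" using I by (simp add: nz_ideal_def)
  have aI: "ideal ((\<lambda>x. a * x) ` I) R"
    using R.nz_ideal_times[of a I] a I by (simp add: nz_ideal_def)
  have Icarr: "x \<in> carrier R" if "x \<in> I" for x using id that ideal.Icarr by metis
  \<comment> \<open>Once the right-hand side is known to be an ideal of \<open>S\<close>, minimality
    of the generated ideal leaves only the generators to check.\<close>
  have "ideal ((\<lambda>y. \<alpha> a * y) ` (Idl\<^bsub>S\<^esub> (\<alpha> ` I))) S"
    using S.nz_ideal_times[OF _ _ extended_ideal_nz[OF I], of "\<alpha> a"] a
    by (simp add: nz_ideal_def \<alpha>_eq_0)
  then show "Idl\<^bsub>S\<^esub> (\<alpha> ` (\<lambda>x. a * x) ` I) \<subseteq> (\<lambda>y. \<alpha> a * y) ` (Idl\<^bsub>S\<^esub> (\<alpha> ` I))"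
    using a Icarr extended_ideal_base[OF id]
    by (intro S.genideal_minimal) (auto simp: \<alpha>_simps)
  show "(\<lambda>y. \<alpha> a * y) ` (Idl\<^bsub>S\<^esub> (\<alpha> ` I)) \<subseteq> Idl\<^bsub>S\<^esub> (\<alpha> ` (\<lambda>x. a * x) ` I)"
  proof clarify
    fix y assume "y \<in> Idl\<^bsub>S\<^esub> (\<alpha> ` I)"
    then obtain A s where A: "finite A" "A \<subseteq> I" "\<And>a. s a \<in> carrier S" "y = (\<Sum>a\<in>A. \<alpha> a * s a)"
      using extended_ideal_elem[OF id] by blast
    have "\<alpha> a * y = (\<Sum>b\<in>A. \<alpha> (a * b) * s b)"
      unfolding A(4) sum_distrib_left using a A Icarr
      by (intro sum.cong) (auto simp: \<alpha>_simps mult.assoc)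
    also have "\<dots> \<in> Idl\<^bsub>S\<^esub> (\<alpha> ` (\<lambda>x. a * x) ` I)"
      using A aI by (intro S_ideal_sum extended_ideal extended_ideal_mult) auto
    finally show "\<alpha> a * y \<in> Idl\<^bsub>S\<^esub> (\<alpha> ` (\<lambda>x. a * x) ` I)" .
  qed
qed

text \<open>The relations in \<open>u\<close> and \<open>s\<close> carry over because \<alpha> is a
  homomorphism that keeps nonzero elements nonzero. Of those in \<open>e\<close>,
  \<open>e_inter\<close> rests on \<open>extended_ideal_inter\<close>, \<open>e_top\<close> on
  \<open>extended_ideal_carrier\<close>, \<open>s_e\<close> on \<open>extended_ideal_times\<close>,
  and \<open>u_e_notin\<close> on \<open>extended_ideal_contract\<close>.\<close>

lemma T_family_extended:
  "T_family R (T_alg S) (\<lambda>x. T_u S (\<alpha> x)) (\<lambda>a. T_s S (\<alpha> a)) (\<lambda>I. T_e S (Idl\<^bsub>S\<^esub> (\<alpha> ` I)))"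
proof -
  note fam = S.T_alg_family[unfolded T_family_def, simplified]
  have notin: "\<alpha> x \<in> carrier S - Idl\<^bsub>S\<^esub> (\<alpha> ` I)" if "nz_ideal R I" "x \<in> carrier R - I" for x I
    using extended_ideal_contract that hom_closed by blast
  have base: "\<alpha> x \<in> Idl\<^bsub>S\<^esub> (\<alpha> ` I)" if "nz_ideal R I" "x \<in> I" for x I
    using extended_ideal_base that by (auto simp: nz_ideal_def)
  show ?thesis
    unfolding T_family_def
    using fam notin base
    by (simp add: \<alpha>_simps(2,3)[symmetric] \<alpha>_eq_0 extended_ideal_nz extended_ideal_inter
        extended_ideal_carrier extended_ideal_times hom_closed)
qed

end

theorem proposition3p2:
  fixes K :: "'a::field_char_0 set" and L :: "'b::field_char_0 set" and \<alpha> :: "'a \<Rightarrow> 'b"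
  defines "R \<equiv> ring_of_integers K" and "S \<equiv> ring_of_integers L"
  assumes "number_field K" and "number_field L"
    and "\<alpha> \<in> ring_hom R S" and "inj_on \<alpha> (carrier R)"
  shows "\<exists>\<phi>. star_hom (T_alg R) (T_alg S) \<phi> \<and>
    (\<forall>x\<in>carrier R. \<phi> (T_u R x) = T_u S (\<alpha> x)) \<and>
    (\<forall>a\<in>carrier R - {\<zero>\<^bsub>R\<^esub>}. \<phi> (T_s R a) = T_s S (\<alpha> a)) \<and>
    (\<forall>I. nz_ideal R I \<longrightarrow> \<phi> (T_e R I) = T_e S (Idl\<^bsub>S\<^esub> (\<alpha> ` I)))"
proof -
  interpret number_ring_hom K L \<alpha> "ring_of_integers K" "ring_of_integers L"
    using assms(3-) unfolding assms(1,2) by unfold_locales simp_all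
  show ?thesis
    unfolding assms(1,2) by (rule R.T_alg_universal[OF S.T_alg_cstar T_family_extended])
qed

end
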